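(* Let $M$ and $Q$ be independent random variables with $\mathbb{P}(M\ge 0,\,Q\ge 0)=1$, and let $R$ be the perpetuity generated by $(M,Q)$. For $x>0$ let $$k(x):=-\log\mathbb{P}(Q>x)\qquad\text{and}\qquad f(x):=-x\log\mathbb{P}(M>1-1/x),$$ and assume that $f\in\mathcal{R}_r$ and $k\in\mathcal{R}_\alpha$ with $r,\alpha>1$. Let $r^\ast$ and $\beta$ denote the conjugate numbers to $r$ and $\alpha$, respectively (i.e. $1/r+1/r^\ast=1$ and $1/\alpha+1/\beta=1$), and let $$\gamma=\frac{\beta r^\ast}{\beta r^\ast-1}.$$ Then $(f^\ast\circ k^\ast)^\ast\in\mathcal{R}_\gamma$ and $$-\log\mathbb{P}(R>x)\sim\left(\frac{\gamma}{\gamma-1}\right)^{\gamma-1}(f^\ast\circ k^\ast)^\ast(x)\qquad\text{as }x\to\infty.$$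
   Context: Notation. $a(x)\sim b(x)$ means $\lim_{x\to\infty}a(x)/b(x)=1$. Regular variation: for $\rho\in\mathbb{R}$, $\mathcal{R}_\rho$ is the class of positive measurable functions $g$ defined in a neighbourhood of $+\infty$ with $\lim_{x\to\infty}g(tx)/g(x)=t^\rho$ for all $t>0$. (A function on a larger domain is said to be in $\mathcal{R}_\rho$ if its restriction to some neighbourhood of $+\infty$ is.) Convex conjugate: for a function $g$ on $(0,\infty)$, $g^\ast(x)=\sup\{xz-g(z):z>0\}$. Perpetuity: the perpetuity $R$ generated by $(M,Q)$ is the (unique in law) random variable satisfying $R\stackrel{d}{=}MR+Q$ with $R$ and $(M,Q)$ independent on the right-hand side; equivalently $R\stackrel{d}{=}\sum_{j=1}^\infty Q_j\prod_{k=1}^{j-1}M_k$, where $(M_n,Q_n)_{n\ge1}$ are i.i.d. copies of $(M,Q)$. *)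

theory Defs
  imports "HOL-Probability.Probability"
begin

definition regularly_varying :: "real \<Rightarrow> (real \<Rightarrow> real) set" where
  "regularly_varying \<rho> =
     {g. (\<exists>a. (\<forall>x>a. g x > 0) \<and> g \<in> borel_measurable (restrict_space borel {a<..})) \<and>
         (\<forall>t>0. ((\<lambda>x. g (t * x) / g x) \<longlongrightarrow> t powr \<rho>) at_top)}"

(* The supremum is taken in the reals, so the value is meaningful only where the set is
   bounded above.  If g is nonnegative on {0<..} and regularly varying with index
   greater than 1, then g z / z tends to infinity, so the set is bounded above for every
   real x. *)
definition convex_conj :: "(real \<Rightarrow> real) \<Rightarrow> real \<Rightarrow> real" where
  "convex_conj g x = Sup {x * z - g z | z. z > 0}"

(* R = MR + Q in law with R independent of (M, Q) on the right-hand side.  Only the law of R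
   matters, so R may live on its own probability space S; the product measure supplies the
   independence.  The lemma perpetuity_iff_indep covers a common space; its
   last assumption is the independence of (X, Y) and R, which indep_var cannot express
   because it needs both variables to have the same value type. *)
definition perpetuity ::
  "'a measure \<Rightarrow> ('a \<Rightarrow> real) \<Rightarrow> ('a \<Rightarrow> real) \<Rightarrow> 'b measure \<Rightarrow> ('b \<Rightarrow> real) \<Rightarrow> bool" where
  "perpetuity P M Q S R \<longleftrightarrow>
     R \<in> borel_measurable S \<and>
     distr S borel R = distr (P \<Otimes>\<^sub>M S) borel (\<lambda>(\<omega>, \<sigma>). M \<omega> * R \<sigma> + Q \<omega>)"

lemma (in prob_space) perpetuity_iff_indep:
  fixes X Y R :: "'a \<Rightarrow> real"
  assumes [measurable]: "X \<in> borel_measurable M" "Y \<in> borel_measurable M"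
      "R \<in> borel_measurable M"
    and eq: "distr M ((borel \<Otimes>\<^sub>M borel) \<Otimes>\<^sub>M borel) (\<lambda>\<omega>. ((X \<omega>, Y \<omega>), R \<omega>)) =
             distr M (borel \<Otimes>\<^sub>M borel) (\<lambda>\<omega>. (X \<omega>, Y \<omega>)) \<Otimes>\<^sub>M distr M borel R"
  shows "perpetuity M X Y M R \<longleftrightarrow>
         distr M borel R = distr M borel (\<lambda>\<omega>. X \<omega> * R \<omega> + Y \<omega>)"
proof -
  let ?A = "borel \<Otimes>\<^sub>M borel :: (real \<times> real) measure"
  let ?h = "\<lambda>(p, r). fst p * r + snd p :: real"
  have rv: "(\<lambda>\<omega>. (X \<omega>, Y \<omega>)) \<in> measurable M ?A" "R \<in> borel_measurable M" by measurable
  have h[measurable]: "?h \<in> borel_measurable (?A \<Otimes>\<^sub>M borel)" by measurable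
  have "distr (M \<Otimes>\<^sub>M M) borel (\<lambda>(\<omega>, \<sigma>). X \<omega> * R \<sigma> + Y \<omega>) =
        distr (distr (M \<Otimes>\<^sub>M M) (?A \<Otimes>\<^sub>M borel) (\<lambda>(\<omega>, \<sigma>). ((X \<omega>, Y \<omega>), R \<sigma>))) borel ?h"
    by (subst distr_distr) (auto simp: comp_def case_prod_beta')
  also have "distr (M \<Otimes>\<^sub>M M) (?A \<Otimes>\<^sub>M borel) (\<lambda>(\<omega>, \<sigma>). ((X \<omega>, Y \<omega>), R \<sigma>)) =
             distr M ?A (\<lambda>\<omega>. (X \<omega>, Y \<omega>)) \<Otimes>\<^sub>M distr M borel R"
    using rv by (intro pair_measure_distr[symmetric] prob_space_imp_sigma_finite prob_space_distr)
  also have "distr \<dots> borel ?h = distr M borel (\<lambda>\<omega>. X \<omega> * R \<omega> + Y \<omega>)"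
    unfolding eq[symmetric] by (subst distr_distr) (auto simp: comp_def)
  finally show ?thesis by (auto simp: perpetuity_def)
qed

end

theory Submission
  imports Defs
begin

text \<open>Write \<open>h = f\<^sup>* \<circ> k\<^sup>*\<close> and let \<open>\<rho>\<close> be its index of regular variation, so that \<open>\<gamma>\<close> is the exponent conjugate to
\<open>\<rho>\<close> and \<open>\<rho> = \<gamma> / (\<gamma> - 1)\<close>.  The heuristic is a Laplace principle for the logarithmic moment generating function
\<open>L\<close> of \<open>R\<close>.  The fixed-point equation says \<open>exp (L z) = E exp (z Q) * E exp (L (z M))\<close>.  Here \<open>log E exp (z Q)\<close> is close
to \<open>k\<^sup>* z\<close>, and with \<open>M = 1 - 1/s\<close> the loss \<open>L z - L (z M)\<close> is close to \<open>z L' z / s\<close>, while the price of this value of \<open>M\<close>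
is \<open>f s / s\<close>.  Minimising over \<open>s\<close> turns the equation into \<open>z L' z = f\<^sup>* (k\<^sup>* z) = h z\<close>, so \<open>L\<close> behaves like
\<open>h / \<rho>\<close>, whose conjugate is \<open>x \<mapsto> h\<^sup>* (\<rho> x) / \<rho>\<close>, which is asymptotic to \<open>\<rho> powr (\<gamma> - 1) * h\<^sup>* x\<close>.

The two bounds on the tail make this rigorous separately.  For the upper bound on \<open>P(R > x)\<close>, the function
\<open>\<Lambda> z = A z + c h z / \<rho>\<close> with \<open>c > 1\<close> is shown to be a supersolution of the equation for \<open>L\<close> (\<open>supersolution_exists\<close>): for large
\<open>z\<close> the slack in \<open>c\<close> absorbs every constant, and for small \<open>z\<close> the linear term does the work.  A supersolution dominates
the moment generating functions of all iterates \<open>x \<mapsto> M x + Q\<close> started at 0, these iterates converge in law to \<open>R\<close>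
because \<open>E M < 1\<close>, and Chernoff's inequality gives \<open>- log P(R > x) \<ge> \<Lambda>\<^sup>* x\<close>.

For the lower bound on \<open>P(R > x)\<close>, the event \<open>R > x\<close> is reached from \<open>R > x - d\<close> when \<open>Q > y\<close> and \<open>M > 1 - 1/s\<close>, with
\<open>d = y - X/s\<close> as long as \<open>x \<le> X\<close>.  If \<open>p\<close> solves \<open>h p = X p\<close> and \<open>y\<close>, \<open>s\<close> nearly attain the suprema defining \<open>k\<^sup>* p\<close>
and \<open>f\<^sup>* (k\<^sup>* p)\<close>, the cost \<open>k y + f s / s\<close> of a step is about \<open>p d\<close> (\<open>near_optimal_step\<close>).  Walking from \<open>X\<close> down to
\<open>l X\<close> with \<open>l\<close> close to 1 costs about \<open>(1 - l) X p\<close>, which is at most about \<open>(1 - l) h\<^sup>* (\<rho> X) / (\<rho> - 1)\<close>; this is about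
the increment of \<open>h\<^sup>* (\<rho> x) / \<rho>\<close> over the block, and summing over geometric blocks gives the claim.

Regular variation of the conjugates and of \<open>h\<close> rests on monotonicity and convexity: a scaling substitution in the
supremum gives it up to a small dilation of the argument, and convexity bounds the effect of that dilation.\<close>

section \<open>Regular variation of monotone functions\<close>

lemma filterlim_mult_const_at_top:
  fixes t :: real assumes "t > 0"
  shows "filterlim (\<lambda>x. t * x) at_top at_top"
  using assms by (intro filterlim_tendsto_pos_mult_at_top[OF tendsto_const _ filterlim_ident])

lemma rv_tendsto:
  assumes "g \<in> regularly_varying \<rho>" "t > 0"
  shows "((\<lambda>x. g (t * x) / g x) \<longlongrightarrow> t powr \<rho>) at_top"
  using assms by (auto simp: regularly_varying_def)

lemma rv_eventually_pos:
  assumes "g \<in> regularly_varying \<rho>"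
  shows "eventually (\<lambda>x. g x > 0) at_top"
  using assms by (auto simp: regularly_varying_def eventually_at_top_dense)

lemma rv_upper:
  assumes "g \<in> regularly_varying \<rho>" "t > 0" "c > t powr \<rho>"
  shows "eventually (\<lambda>x. g (t * x) \<le> c * g x) at_top"
proof -
  have "eventually (\<lambda>x. g (t * x) / g x < c) at_top"
    by (rule order_tendstoD(2)[OF rv_tendsto[OF assms(1,2)] assms(3)])
  then show ?thesis
    using rv_eventually_pos[OF assms(1)]
    by eventually_elim (simp add: field_simps)
qed

lemma rv_lower:
  assumes "g \<in> regularly_varying \<rho>" "t > 0" "c < t powr \<rho>"
  shows "eventually (\<lambda>x. c * g x \<le> g (t * x)) at_top"
proof -
  have "eventually (\<lambda>x. c < g (t * x) / g x) at_top"
    by (rule order_tendstoD(1)[OF rv_tendsto[OF assms(1,2)] assms(3)])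
  then show ?thesis
    using rv_eventually_pos[OF assms(1)]
    by eventually_elim (simp add: field_simps)
qed

text \<open>Limits below are all established with multiplicative slack \<open>c > 1\<close>, since slack factors can be composed and
absorbed by the index of regular variation.\<close>

lemma tendsto_sandwich_factor:
  fixes F :: "'a filter" and u :: "'a \<Rightarrow> real"
  assumes L: "L > 0"
    and up: "\<And>c. c > 1 \<Longrightarrow> eventually (\<lambda>x. u x \<le> c * L) F"
    and lo: "\<And>c. c > 1 \<Longrightarrow> eventually (\<lambda>x. L / c \<le> u x) F"
  shows "(u \<longlongrightarrow> L) F"
proof (rule order_tendstoI)
  fix a assume a: "a < L"
  define c where "c = (if a \<le> 0 then 2 else (1 + L / a) / 2)"
  have c: "c > 1" using a L by (auto simp: c_def field_simps)
  have "a < L / c"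
  proof (cases "a \<le> 0")
    case True
    then show ?thesis using L by (simp add: c_def)
  next
    case False
    then have "a * c = (a + L) / 2" by (simp add: c_def field_simps)
    then show ?thesis using a c by (simp add: field_simps)
  qed
  with lo[OF c] show "eventually (\<lambda>x. a < u x) F"
    by (auto elim: eventually_mono)
next
  fix a assume a: "L < a"
  define c where "c = (1 + a / L) / 2"
  have c: "c > 1" and "c * L < a" using a L by (auto simp: c_def field_simps)
  with up[OF c] show "eventually (\<lambda>x. u x < a) F"
    by (auto elim: eventually_mono)
qed

text \<open>An upper bound for every \<open>t\<close> suffices: the lower bound at \<open>t\<close> is the upper bound at \<open>1 / t\<close>, applied
at the point \<open>t * x\<close>.\<close>

lemma mono_imp_regularly_varying:
  assumes "mono g" and pos: "eventually (\<lambda>x. g x > 0) at_top"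
    and up: "\<And>t c. t > 0 \<Longrightarrow> c > 1 \<Longrightarrow> eventually (\<lambda>x. g (t * x) \<le> c * t powr \<rho> * g x) at_top"
  shows "g \<in> regularly_varying \<rho>"
proof -
  obtain a where a: "\<forall>x>a. g x > 0"
    using pos by (auto simp: eventually_at_top_dense)
  have "g \<in> borel_measurable (restrict_space borel {a<..})"
    by (intro measurable_restrict_space1 borel_measurable_mono assms(1))
  moreover have "((\<lambda>x. g (t * x) / g x) \<longlongrightarrow> t powr \<rho>) at_top" if t: "t > 0" for t
  proof (rule tendsto_sandwich_factor)
    show "0 < t powr \<rho>" using t by simp
    show "eventually (\<lambda>x. g (t * x) / g x \<le> c * t powr \<rho>) at_top" if "c > 1" for c
      using up[OF t that] pos by eventually_elim (simp add: field_simps)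
    show "eventually (\<lambda>x. t powr \<rho> / c \<le> g (t * x) / g x) at_top" if c: "c > 1" for c
    proof -
      have "filterlim (\<lambda>x. t * x) at_top at_top"
        by (rule filterlim_mult_const_at_top[OF t])
      moreover have "eventually (\<lambda>x. g (1 / t * x) \<le> c * (1 / t) powr \<rho> * g x) at_top"
        using up[of "1 / t" c] t c by simp
      ultimately have "eventually (\<lambda>x. g (1 / t * (t * x)) \<le> c * (1 / t) powr \<rho> * g (t * x)) at_top"
        by (rule eventually_compose_filterlim[rotated])
      then show ?thesis using pos
        by eventually_elim (use t c in \<open>simp add: powr_divide field_simps\<close>)
    qed
  qed
  ultimately show ?thesis using a by (auto simp: regularly_varying_def)
qed

text \<open>Finiteness of the conjugate at every point requires exactly this growth, and nonnegativity keeps the values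
of the conjugand at small arguments from influencing estimates.\<close>

definition superlinear :: "(real \<Rightarrow> real) \<Rightarrow> bool" where
  "superlinear g \<longleftrightarrow> (\<forall>z>0. 0 \<le> g z) \<and> filterlim (\<lambda>x. g x / x) at_top at_top"

lemma superlinear_nonneg: "superlinear g \<Longrightarrow> z > 0 \<Longrightarrow> 0 \<le> g z"
  by (simp add: superlinear_def)

lemma superlinear_eventually:
  assumes "superlinear g" shows "eventually (\<lambda>x. C * x \<le> g x) at_top"
proof -
  have "eventually (\<lambda>x. C \<le> g x / x) at_top"
    using assms by (auto simp: superlinear_def filterlim_at_top)
  then show ?thesis using eventually_gt_at_top[of 0]
    by eventually_elim (simp add: field_simps)
qed

lemma superlinearI:
  assumes "\<And>z. z > 0 \<Longrightarrow> 0 \<le> g z" "\<And>C. eventually (\<lambda>x. C * x \<le> g x) at_top"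
  shows "superlinear g"
  unfolding superlinear_def filterlim_at_top
proof (intro conjI allI impI)
  fix C :: real
  show "eventually (\<lambda>x. C \<le> g x / x) at_top"
    using assms(2)[of C] eventually_gt_at_top[of 0]
    by eventually_elim (simp add: field_simps)
qed (use assms in auto)

text \<open>Doubling the argument multiplies \<open>g\<close> by a factor \<open>q > 2\<close>, so \<open>g x / x\<close> grows geometrically along \<open>2 ^ n * z\<close>;
monotonicity fills the gaps between these points.\<close>

lemma rv_superlinear:
  assumes rv: "g \<in> regularly_varying \<rho>" and \<rho>: "\<rho> > 1"
    and mono: "mono_on {0<..} g" and nonneg: "\<And>z. z > 0 \<Longrightarrow> 0 \<le> g z"
  shows "superlinear g"
proof (rule superlinearI)
  fix C :: real
  \<comment> \<open>any number strictly between \<open>2\<close> and \<open>2 powr \<rho>\<close>\<close>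
  define q where "q = 2 powr ((1 + \<rho>) / 2)"
  have q: "q > 2" "q < 2 powr \<rho>"
    using \<rho> powr_less_mono[of 1 "(1 + \<rho>) / 2" 2] powr_less_mono[of "(1 + \<rho>) / 2" \<rho> 2]
    by (auto simp: q_def)
  have "eventually (\<lambda>x. q * g x \<le> g (2 * x) \<and> g x > 0) at_top"
    using rv_lower[OF rv _ q(2)] rv_eventually_pos[OF rv] by (simp add: eventually_conj)
  then obtain N where N: "\<And>x. x \<ge> N \<Longrightarrow> q * g x \<le> g (2 * x) \<and> g x > 0"
    by (auto simp: eventually_at_top_linorder)
  define z where "z = max N 1"
  have z: "z > 0" "z \<ge> N" by (auto simp: z_def)
  have pw: "q ^ n * g z \<le> g (2 ^ n * z)" for n
  proof (induction n)
    case (Suc n)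
    have "N \<le> 2 ^ n * z" using z mult_right_mono[of 1 "2 ^ n" z] one_le_power[of "2::real" n] by linarith
    then have "q * g (2 ^ n * z) \<le> g (2 * (2 ^ n * z))" using N by blast
    moreover have "q * (q ^ n * g z) \<le> q * g (2 ^ n * z)" using Suc q by simp
    ultimately show ?case by (simp add: mult_ac)
  qed simp
  define B where "B = 2 * \<bar>C\<bar> * z / g z"
  have gz: "g z > 0" using N z by auto
  obtain n0 where "B < (q / 2) ^ n0" using real_arch_pow[of "q / 2" B] q by auto
  moreover have "(q / 2) ^ n0 \<le> (q / 2) ^ n" if "n \<ge> n0" for n
    using that q by (intro power_increasing) auto
  ultimately have n0: "B \<le> (q / 2) ^ n" if "n \<ge> n0" for n
    using that by fastforce
  have "C * x \<le> g x" if x: "x \<ge> 2 ^ n0 * z" for x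
  proof -
    have x0: "x > 0" using x z by (smt (verit) mult_pos_pos zero_less_power)
    define n where "n = nat \<lfloor>log 2 (x / z)\<rfloor>"
    have xz: "x / z \<ge> 2 ^ n0" using x z by (simp add: field_simps)
    have "real n0 = log 2 (2 ^ n0)" by simp
    also have "\<dots> \<le> log 2 (x / z)" using xz x0 z by (intro log_mono) auto
    finally have l: "real n0 \<le> log 2 (x / z)" .
    have n: "real n \<le> log 2 (x / z)" "log 2 (x / z) < real n + 1" "n0 \<le> n"
      using l unfolding n_def by linarith+
    have "2 powr (real n) \<le> 2 powr (log 2 (x / z))" using n by (intro powr_mono) auto
    then have lo: "2 ^ n * z \<le> x" using x0 z by (simp add: powr_realpow field_simps)
    have "2 powr (log 2 (x / z)) \<le> 2 powr (real n + 1)" using n by (intro powr_mono) auto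
    then have hi: "x \<le> 2 * 2 ^ n * z" using x0 z by (simp add: powr_add powr_realpow field_simps)
    have "C * x \<le> \<bar>C\<bar> * x" using x0 by (intro mult_right_mono) auto
    also have "\<dots> \<le> \<bar>C\<bar> * (2 * 2 ^ n * z)" using hi by (intro mult_left_mono) auto
    also have "\<dots> = B * 2 ^ n * g z" using gz by (simp add: B_def field_simps)
    also have "\<dots> \<le> (q / 2) ^ n * 2 ^ n * g z" using n0[OF n(3)] gz by (intro mult_right_mono) auto
    also have "\<dots> = q ^ n * g z" by (simp flip: power_mult_distrib)
    also have "\<dots> \<le> g (2 ^ n * z)" by (rule pw)
    also have "\<dots> \<le> g x" using lo z x0 by (intro mono_onD[OF mono]) auto
    finally show ?thesis .
  qed
  then show "eventually (\<lambda>x. C * x \<le> g x) at_top"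
    by (auto simp: eventually_at_top_linorder)
qed (use nonneg in auto)

section \<open>Convex conjugates and regular variation\<close>

lemma convex_conj_bdd_above:
  assumes "superlinear g" shows "bdd_above {x * z - g z | z. z > 0}"
proof -
  obtain N where N: "\<And>z. z \<ge> N \<Longrightarrow> x * z \<le> g z"
    using superlinear_eventually[OF assms, of x] by (auto simp: eventually_at_top_linorder)
  have "x * z - g z \<le> \<bar>x\<bar> * \<bar>N\<bar>" if z: "z > 0" for z
  proof (cases "z \<ge> N")
    case True
    then show ?thesis using N[OF True] mult_nonneg_nonneg[of "\<bar>x\<bar>" "\<bar>N\<bar>"] by linarith
  next
    case False
    then have "x * z \<le> \<bar>x\<bar> * \<bar>N\<bar>" using z by (intro mult_mono) auto
    then show ?thesis using superlinear_nonneg[OF assms z] by linarith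
  qed
  then show ?thesis by (auto intro!: bdd_aboveI[of _ "\<bar>x\<bar> * \<bar>N\<bar>"])
qed

lemma convex_conj_ge:
  assumes "superlinear g" "z > 0"
  shows "x * z - g z \<le> convex_conj g x"
  unfolding convex_conj_def
  by (rule cSup_upper[OF _ convex_conj_bdd_above[OF assms(1)]]) (use assms in auto)

lemma convex_conj_le:
  assumes "\<And>z. z > 0 \<Longrightarrow> x * z - g z \<le> c"
  shows "convex_conj g x \<le> c"
  unfolding convex_conj_def
  by (rule cSup_least) (use assms in \<open>auto intro: exI[of _ "1::real"]\<close>)

lemma convex_conj_approx:
  assumes "c < convex_conj g x"
  obtains z where "z > 0" "c < x * z - g z"
  using convex_conj_le[of x g c] assms by (meson not_le)

lemma mono_convex_conj:
  assumes "superlinear g" shows "mono (convex_conj g)"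
proof
  fix x y :: real assume "x \<le> y"
  show "convex_conj g x \<le> convex_conj g y"
  proof (rule convex_conj_le)
    fix z :: real assume z: "z > 0"
    have "x * z - g z \<le> y * z - g z" using \<open>x \<le> y\<close> z by (simp add: mult_right_mono)
    also have "\<dots> \<le> convex_conj g y" by (rule convex_conj_ge[OF assms z])
    finally show "x * z - g z \<le> convex_conj g y" .
  qed
qed

lemma convex_on_convex_conj:
  assumes "superlinear g" shows "convex_on UNIV (convex_conj g)"
proof (rule convex_onI)
  fix t x y :: real assume t: "0 < t" "t < 1"
  show "convex_conj g ((1 - t) *\<^sub>R x + t *\<^sub>R y) \<le> (1 - t) * convex_conj g x + t * convex_conj g y"
  proof (rule convex_conj_le)
    fix z :: real assume z: "z > 0"
    have "((1 - t) *\<^sub>R x + t *\<^sub>R y) * z - g z = (1 - t) * (x * z - g z) + t * (y * z - g z)"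
      by (simp add: algebra_simps)
    also have "\<dots> \<le> (1 - t) * convex_conj g x + t * convex_conj g y"
      using t z by (intro add_mono mult_left_mono convex_conj_ge[OF assms]) auto
    finally show "((1 - t) *\<^sub>R x + t *\<^sub>R y) * z - g z \<le> (1 - t) * convex_conj g x + t * convex_conj g y" .
  qed
qed auto

text \<open>A conjugate dominates each of the affine functions \<open>x \<mapsto> x * z - g z\<close>, whose slopes \<open>z\<close> are arbitrary.\<close>

lemma convex_conj_eventually_ge:
  assumes "superlinear g" shows "eventually (\<lambda>x. C * x \<le> convex_conj g x) at_top"
proof -
  define z where "z = max 1 (C + 1)"
  have z: "z > 0" "z \<ge> C + 1" by (auto simp: z_def)
  have "eventually (\<lambda>x::real. x \<ge> max 0 (g z)) at_top" by (rule eventually_ge_at_top)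
  then show ?thesis
  proof eventually_elim
    case (elim x)
    have "C * x + x \<le> x * z" using elim z mult_left_mono[of "C + 1" z x] by (simp add: algebra_simps)
    then show ?case using convex_conj_ge[OF assms z(1), of x] elim by linarith
  qed
qed

text \<open>Substituting \<open>z = t powr (\<sigma> - 1) * w\<close> in the supremum that defines the conjugate at \<open>t * x\<close> gives
\<open>t powr \<sigma> * x * w - g (t powr (\<sigma> - 1) * w)\<close>, and regular variation replaces the last term by \<open>t powr \<sigma> * g w\<close> up to the
factor \<open>1 / l\<close>, because \<open>(\<sigma> - 1) * \<rho> = \<sigma>\<close>.  Small \<open>w\<close>, where this replacement is not available, contribute
only linearly in \<open>x\<close>.\<close>

lemma convex_conj_subst_bound:
  assumes rv: "g \<in> regularly_varying \<rho>" and \<rho>: "\<rho> > 1" and sup: "superlinear g"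
    and t: "t > 0" and l: "l > 1"
  defines "\<sigma> \<equiv> \<rho> / (\<rho> - 1)"
  shows "eventually (\<lambda>x. convex_conj g (t * x) \<le> t powr \<sigma> / l * convex_conj g (l * x)) at_top"
proof -
  define a where "a = t powr (\<sigma> - 1)"
  have a: "a > 0" using t by (simp add: a_def)
  have ta: "t * a = t powr \<sigma>"
    using t powr_add[of t 1 "\<sigma> - 1"] by (simp add: a_def)
  have "(\<sigma> - 1) * \<rho> = \<sigma>" using \<rho> by (simp add: \<sigma>_def field_simps)
  then have ar: "a powr \<rho> = t powr \<sigma>" by (simp add: a_def powr_powr)
  have T: "t powr \<sigma> > 0" using t by simp
  have "t powr \<sigma> / l < a powr \<rho>" using ar l T by (simp add: field_simps)
  from rv_lower[OF rv a this] obtain N where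
    N: "\<And>w. w \<ge> N \<Longrightarrow> t powr \<sigma> / l * g w \<le> g (a * w)"
    by (auto simp: eventually_at_top_linorder)
  have "filterlim (\<lambda>x. l * x) at_top at_top"
    using l by (intro filterlim_mult_const_at_top) auto
  from eventually_compose_filterlim[OF convex_conj_eventually_ge[OF sup, of "max 0 N"] this]
  show ?thesis using eventually_gt_at_top[of 0]
  proof eventually_elim
    case (elim x)
    show ?case
    proof (rule convex_conj_le)
      fix z :: real assume z: "z > 0"
      define w where "w = z / a"
      have w: "w > 0" "z = a * w" using z a by (auto simp: w_def)
      show "t * x * z - g z \<le> t powr \<sigma> / l * convex_conj g (l * x)"
      proof (cases "w \<ge> N")
        case True
        have "t * x * z - g z = t powr \<sigma> * x * w - g (a * w)"
          by (simp add: w(2) flip: ta)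
        also have "\<dots> \<le> t powr \<sigma> * x * w - t powr \<sigma> / l * g w" using N[OF True] by simp
        also have "\<dots> = t powr \<sigma> / l * (l * x * w - g w)" using l by (simp add: field_simps)
        also have "\<dots> \<le> t powr \<sigma> / l * convex_conj g (l * x)"
          using l T w by (intro mult_left_mono convex_conj_ge[OF sup]) auto
        finally show ?thesis .
      next
        case False
        have "t * x * z - g z \<le> t * x * z" using superlinear_nonneg[OF sup z] by simp
        also have "\<dots> = t powr \<sigma> / l * (w * (l * x))" using l by (simp add: w(2) flip: ta)
        also have "\<dots> \<le> t powr \<sigma> / l * (max 0 N * (l * x))"
          using False l T elim by (intro mult_left_mono mult_right_mono) auto
        also have "\<dots> \<le> t powr \<sigma> / l * convex_conj g (l * x)"
          using elim T l by (intro mult_left_mono) auto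
        finally show ?thesis .
      qed
    qed
  qed
qed

text \<open>It remains to remove the factor \<open>l\<close> in the argument.  The substitution bound with \<open>t = 4\<close> and \<open>l = 2\<close> shows that
doubling the argument costs a bounded factor \<open>D\<close>; by convexity the conjugate at \<open>l * x\<close> then exceeds the
conjugate at \<open>x\<close> by a factor of at most \<open>1 + (l - 1) * D\<close>.\<close>

lemma regularly_varying_convex_conj:
  assumes rv: "g \<in> regularly_varying \<rho>" and \<rho>: "\<rho> > 1" and sup: "superlinear g"
  shows "convex_conj g \<in> regularly_varying (\<rho> / (\<rho> - 1))"
proof (rule mono_imp_regularly_varying)
  define \<sigma> where "\<sigma> = \<rho> / (\<rho> - 1)"
  have pos: "eventually (\<lambda>x. convex_conj g x > 0) at_top"
    using convex_conj_eventually_ge[OF sup, of 1] eventually_gt_at_top[of 0]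
    by eventually_elim auto
  then show "eventually (\<lambda>x. convex_conj g x > 0) at_top" .
  show "mono (convex_conj g)" by (rule mono_convex_conj[OF sup])
  fix t c :: real assume t: "t > 0" and c: "c > 1"
  define D where "D = (4::real) powr \<sigma>"
  have D: "D > 0" by (simp add: D_def)
  have "filterlim (\<lambda>x::real. 1 / 2 * x) at_top at_top"
    by (intro filterlim_mult_const_at_top) auto
  from eventually_compose_filterlim[OF convex_conj_subst_bound[OF rv \<rho> sup, of 4 2] this]
  have dbl: "eventually (\<lambda>x. convex_conj g (2 * x) \<le> D / 2 * convex_conj g x) at_top"
    by (simp add: D_def \<sigma>_def)
  define l where "l = 1 + min 1 ((c - 1) / D)"
  have l: "l > 1" "l \<le> 2" using c D by (auto simp: l_def)
  have "(l - 1) * D \<le> (c - 1) / D * D" using D by (intro mult_right_mono) (auto simp: l_def)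
  then have lD: "(l - 1) * D \<le> c - 1" using D by simp
  show "eventually (\<lambda>x. convex_conj g (t * x) \<le> c * t powr (\<rho> / (\<rho> - 1)) * convex_conj g x) at_top"
    using convex_conj_subst_bound[OF rv \<rho> sup t l(1)] dbl pos
  proof eventually_elim
    case (elim x)
    have "l * x = (1 - (l - 1)) * x + (l - 1) * (2 * x)" by (simp add: algebra_simps)
    then have "convex_conj g (l * x) \<le> (1 - (l - 1)) * convex_conj g x + (l - 1) * convex_conj g (2 * x)"
      using convex_onD[OF convex_on_convex_conj[OF sup], of "l - 1" x "2 * x"] l by simp
    also have "\<dots> \<le> 1 * convex_conj g x + (l - 1) * (D * convex_conj g x)"
    proof (intro add_mono mult_left_mono mult_right_mono)
      have "D / 2 * convex_conj g x \<le> D * convex_conj g x"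
        using elim D by (intro mult_right_mono) auto
      then show "convex_conj g (2 * x) \<le> D * convex_conj g x" using elim by linarith
    qed (use l elim in auto)
    also have "\<dots> = (1 + (l - 1) * D) * convex_conj g x" by (simp add: algebra_simps)
    also have "\<dots> \<le> c * convex_conj g x" using lD elim by (intro mult_right_mono) auto
    finally have *: "convex_conj g (l * x) \<le> c * convex_conj g x" .
    have "convex_conj g (t * x) \<le> t powr \<sigma> / l * convex_conj g (l * x)"
      using elim by (simp add: \<sigma>_def)
    also have "\<dots> \<le> t powr \<sigma> / l * (c * convex_conj g x)"
      using * l by (intro mult_left_mono) auto
    also have "\<dots> \<le> t powr \<sigma> / 1 * (c * convex_conj g x)"
      using l c elim by (intro mult_right_mono divide_left_mono) auto
    finally show ?case by (simp add: \<sigma>_def mult_ac)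
  qed
qed

text \<open>Monotonicity of the outer function supplies the local uniformity of its limit: an error factor \<open>c1\<close> in the
inner function becomes \<open>c1 powr a\<close> outside.\<close>

lemma regularly_varying_comp:
  assumes F: "F \<in> regularly_varying a" "mono F" and a: "a > 0"
    and G: "G \<in> regularly_varying b" "mono G" "filterlim G at_top at_top"
  shows "F \<circ> G \<in> regularly_varying (a * b)"
proof (rule mono_imp_regularly_varying)
  show "mono (F \<circ> G)" using F(2) G(2) by (auto simp: mono_def)
  show "eventually (\<lambda>x. 0 < (F \<circ> G) x) at_top"
    using eventually_compose_filterlim[OF rv_eventually_pos[OF F(1)] G(3)] by simp
  fix t c :: real assume t: "t > 0" and c: "c > 1"
  define c1 where "c1 = c powr (1 / (a + 1))"
  have c1: "c1 > 1" using c a by (simp add: c1_def)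
  have c1c: "c1 powr (a + 1) = c" using c a by (simp add: c1_def powr_powr)
  define s where "s = c1 * t powr b"
  have s: "s > 0" "s > t powr b" using c1 t by (auto simp: s_def)
  have "s powr a = c1 powr a * t powr (a * b)"
    using c1 t by (simp add: s_def powr_mult powr_powr mult.commute)
  also have "\<dots> < c * t powr (a * b)"
    using c1 t by (subst c1c[symmetric]) (auto intro!: mult_strict_right_mono powr_less_mono)
  finally have "s powr a < c * t powr (a * b)" .
  from eventually_compose_filterlim[OF rv_upper[OF F(1) s(1) this] G(3)] rv_upper[OF G(1) t s(2)]
  show "eventually (\<lambda>x. (F \<circ> G) (t * x) \<le> c * t powr (a * b) * (F \<circ> G) x) at_top"
  proof eventually_elim
    case (elim x)
    have "F (G (t * x)) \<le> F (s * G x)" using F(2) elim by (simp add: monoD)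
    with elim show ?case by simp
  qed
qed

section \<open>Increments of convex regularly varying functions\<close>

lemma convex_slope_mono:
  fixes h :: "real \<Rightarrow> real"
  assumes h: "convex_on UNIV h" and "a < b" "b \<le> c" "c < d"
  shows "(h b - h a) * (d - c) \<le> (h d - h c) * (b - a)"
proof -
  have "(h a - h b) / (a - b) \<le> (h a - h d) / (a - d)"
    using convex_on_slope_le(1)[OF h, of a d b] assms by auto
  also have "\<dots> \<le> (h c - h d) / (c - d)"
    using convex_on_slope_le(2)[OF h, of a d c] assms by auto
  finally have "(h b - h a) / (b - a) \<le> (h d - h c) / (d - c)"
    by (metis minus_diff_eq minus_divide_divide)
  then show ?thesis using assms by (simp add: field_simps)
qed

lemma powr_diff_lower_bound:
  fixes u v a :: real
  assumes u: "0 < u" "u < v" and a: "a > 1"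
  shows "a * u powr (a - 1) * (v - u) \<le> v powr a - u powr a"
proof -
  have "\<exists>l w. u < w \<and> w < v \<and> DERIV (\<lambda>x. x powr a) w :> l \<and> v powr a - u powr a = (v - u) * l"
  proof (rule MVT[OF u(2)])
    show "continuous_on {u..v} (\<lambda>x. x powr a)" using u by (intro continuous_intros) auto
    show "(\<lambda>x. x powr a) differentiable at x" if "u < x" "x < v" for x
      using that u by (auto intro!: derivative_eq_intros simp: real_differentiable_def)
  qed
  then obtain l w where w: "u < w" "w < v" "DERIV (\<lambda>x. x powr a) w :> l"
    "v powr a - u powr a = (v - u) * l" by blast
  have "DERIV (\<lambda>x. x powr a) w :> a * w powr (a - 1)"
    using w u by (auto intro!: derivative_eq_intros)
  with w(3) have l: "l = a * w powr (a - 1)" by (rule DERIV_unique)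
  have "a * u powr (a - 1) * (v - u) \<le> l * (v - u)"
    unfolding l using w u a by (intro mult_right_mono mult_left_mono powr_mono2) auto
  then show ?thesis using w(4) by (simp add: mult.commute)
qed

text \<open>A quantitative substitute for \<open>z * h' z \<sim> \<rho> * h z\<close>.  Convexity bounds the slopes on \<open>[z * m, z]\<close> below by the slope
over \<open>[u * z, v * z]\<close> with \<open>u < v < 1\<close> near 1, and the latter is given by regular variation.  For \<open>m\<close> away from 1 only the
part of the increment beyond \<open>v * z\<close> is kept, whence the minimum with \<open>\<delta>\<close>.\<close>

lemma convex_rv_increment:
  assumes h: "convex_on UNIV h" "mono h" "h \<in> regularly_varying \<rho>" and \<rho>: "\<rho> > 1" and c: "c > 1"
  obtains \<delta> where "\<delta> > 0"
    "eventually (\<lambda>z. \<forall>m\<in>{0..1}. \<rho> / c * h z * min (1 - m) \<delta> \<le> h z - h (z * m)) at_top"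
proof -
  \<comment> \<open>close enough to 1 for \<open>u powr (\<rho> - 1)\<close>, the derivative of \<open>x powr \<rho>\<close> at \<open>u\<close> up to the factor \<open>\<rho>\<close>, to exceed \<open>1 / c\<close>\<close>
  define u where "u = max (1 / 2) (c powr (- 1 / (2 * (\<rho> - 1))))"
  have "c powr (- 1 / (2 * (\<rho> - 1))) < 1"
    using c \<rho> powr_less_mono[of "- 1 / (2 * (\<rho> - 1))" 0 c] by (auto simp: field_simps)
  then have u: "u > 0" "u < 1" by (auto simp: u_def)
  have "(c powr (- 1 / (2 * (\<rho> - 1)))) powr (\<rho> - 1) \<le> u powr (\<rho> - 1)"
    using \<rho> by (intro powr_mono2) (auto simp: u_def)
  moreover have "- 1 / (2 * (\<rho> - 1)) * (\<rho> - 1) = - 1 / 2" using \<rho> by (simp add: field_simps)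
  ultimately have "c powr (- 1 / 2) \<le> u powr (\<rho> - 1)" by (simp only: powr_powr)
  moreover have "c powr (-1) < c powr (- 1 / 2)" using c by (intro powr_less_mono) auto
  ultimately have "c powr (-1) < u powr (\<rho> - 1)" by linarith
  then have uc: "1 / c < u powr (\<rho> - 1)" using c by (simp add: powr_minus_divide)
  define \<delta> where "\<delta> = (1 - u) / 2"
  define v where "v = u + \<delta>"
  have \<delta>: "\<delta> > 0" "v = 1 - \<delta>" "u < v" "v < 1" using u by (auto simp: \<delta>_def v_def field_simps)
  have "\<delta> * (\<rho> / c) < \<delta> * (\<rho> * u powr (\<rho> - 1))"
    using mult_strict_left_mono[OF uc, of \<rho>] \<delta>(1) \<rho> by (intro mult_strict_left_mono) auto
  also have "\<dots> \<le> v powr \<rho> - u powr \<rho>"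
    using powr_diff_lower_bound[OF u(1) \<delta>(3), of \<rho>] \<rho> by (simp add: v_def mult_ac)
  finally have gap: "\<delta> * (\<rho> / c) < v powr \<rho> - u powr \<rho>" .
  define \<tau> where "\<tau> = (v powr \<rho> - u powr \<rho> - \<delta> * (\<rho> / c)) / 2"
  have \<tau>: "\<tau> > 0" using gap by (simp add: \<tau>_def)
  have "eventually (\<lambda>z. (v powr \<rho> - \<tau>) * h z \<le> h (v * z)) at_top"
    using \<tau> \<delta> u by (intro rv_lower[OF h(3)]) auto
  moreover have "eventually (\<lambda>z. h (u * z) \<le> (u powr \<rho> + \<tau>) * h z) at_top"
    using \<tau> \<delta> u by (intro rv_upper[OF h(3)]) auto
  ultimately have ev: "eventually (\<lambda>z. \<forall>m\<in>{0..1}. \<rho> / c * h z * min (1 - m) \<delta> \<le> h z - h (z * m)) at_top"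
    using rv_eventually_pos[OF h(3)] eventually_gt_at_top[of 0]
  proof eventually_elim
    case (elim z)
    have "v powr \<rho> - \<tau> - (u powr \<rho> + \<tau>) = \<delta> * (\<rho> / c)" by (simp add: \<tau>_def)
    then have "\<delta> * (\<rho> / c) * h z = (v powr \<rho> - \<tau>) * h z - (u powr \<rho> + \<tau>) * h z"
      by (metis left_diff_distrib)
    with elim have inc: "\<delta> * (\<rho> / c) * h z \<le> h (v * z) - h (u * z)" by linarith
    have big: "\<rho> / c * h z * (1 - m) \<le> h z - h (z * m)" if m: "v \<le> m" "m \<le> 1" for m
    proof (cases "m = 1")
      case False
      then have "m < 1" using m by simp
      have "(h (v * z) - h (u * z)) * (z - z * m) \<le> (h z - h (z * m)) * (v * z - u * z)"
        using elim \<delta> m \<open>m < 1\<close> by (intro convex_slope_mono[OF h(1)]) auto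
      moreover have "\<delta> * (\<rho> / c) * h z * (z - z * m) \<le> (h (v * z) - h (u * z)) * (z - z * m)"
        using inc m elim by (intro mult_right_mono) (auto simp: mult_left_le)
      ultimately have "(\<rho> / c * h z * (1 - m)) * (\<delta> * z) \<le> (h z - h (z * m)) * (\<delta> * z)"
        by (simp add: v_def algebra_simps)
      then show ?thesis by (rule mult_right_le_imp_le) (use \<delta> elim in simp)
    qed simp
    show ?case
    proof
      fix m :: real assume m: "m \<in> {0..1}"
      show "\<rho> / c * h z * min (1 - m) \<delta> \<le> h z - h (z * m)"
      proof (cases "v \<le> m")
        case True
        have "\<rho> / c * h z * min (1 - m) \<delta> \<le> \<rho> / c * h z * (1 - m)"
          using elim \<rho> c by (intro mult_left_mono) auto
        also have "\<dots> \<le> h z - h (z * m)" using big True m by auto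
        finally show ?thesis .
      next
        case False
        have "\<rho> / c * h z * min (1 - m) \<delta> \<le> \<rho> / c * h z * (1 - v)"
          using elim \<rho> c \<delta> by (intro mult_left_mono) auto
        also have "\<dots> \<le> h z - h (z * v)" using big[of v] \<delta> by auto
        also have "\<dots> \<le> h z - h (z * m)"
          using False elim by (intro diff_left_mono monoD[OF h(2)]) auto
        finally show ?thesis .
      qed
    qed
  qed
  show ?thesis by (rule that[OF \<delta>(1) ev])
qed

text \<open>The optimal dual variable \<open>p\<close> at level \<open>X\<close>.  It solves \<open>h p = X * p\<close>, and a prescribed lower bound \<open>p0\<close> makes
asymptotic statements in \<open>p\<close> available for all large \<open>X\<close>.\<close>

lemma eventually_tangent_point:
  assumes h: "convex_on UNIV h" "superlinear h" and p0: "p0 > 0"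
  shows "eventually (\<lambda>X. \<exists>p\<ge>p0. h p = X * p) at_top"
  using eventually_ge_at_top[of "h p0 / p0"]
proof eventually_elim
  case (elim X)
  obtain N where N: "\<And>p. p \<ge> N \<Longrightarrow> X * p \<le> h p"
    using superlinear_eventually[OF h(2), of X] by (auto simp: eventually_at_top_linorder)
  have "continuous_on UNIV h" by (rule convex_on_continuous[OF open_UNIV h(1)])
  then have "continuous_on {p0..max p0 N} (\<lambda>p. h p - X * p)"
    by (intro continuous_intros) (auto intro: continuous_on_subset)
  then have "\<exists>p. p0 \<le> p \<and> p \<le> max p0 N \<and> h p - X * p = 0"
    using N[of "max p0 N"] elim p0 by (intro IVT') (auto simp: field_simps)
  then show ?case by auto
qed

section \<open>The rate function and its optimal paths\<close>

text \<open>Telescoping over the geometric blocks \<open>[l ^ (n + 1) * x, l ^ n * x]\<close>; \<open>C\<close> accounts for the part of the path below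
the level where the block estimate starts to hold.\<close>

lemma block_recursion_bound:
  fixes \<psi> \<Psi> :: "real \<Rightarrow> real"
  assumes mono: "mono \<psi>" and l: "0 < l" "l < 1"
    and lb: "\<And>x. x > 0 \<Longrightarrow> B \<le> \<Psi> x"
    and step: "eventually (\<lambda>x. \<psi> x - \<psi> (l * x) \<le> \<Psi> x - \<Psi> (l * x)) at_top"
  obtains C where "eventually (\<lambda>x. \<psi> x \<le> \<Psi> x + C) at_top"
proof -
  from step obtain X0 where X0: "\<And>x. x \<ge> X0 \<Longrightarrow> \<psi> x - \<psi> (l * x) \<le> \<Psi> x - \<Psi> (l * x)"
    by (auto simp: eventually_at_top_linorder)
  define X where "X = max X0 1"
  have X: "X > 0" "X \<ge> X0" by (auto simp: X_def)
  define C where "C = \<psi> X - B"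
  have claim: "\<psi> x \<le> \<Psi> x + C" if "0 < x" "l ^ n * x \<le> X" for n x
    using that
  proof (induction n arbitrary: x)
    case 0
    then show ?case using monoD[OF mono, of x X] lb[of x] by (simp add: C_def)
  next
    case (Suc n)
    show ?case
    proof (cases "x \<le> X")
      case True
      then show ?thesis using monoD[OF mono, of x X] lb[of x] Suc by (simp add: C_def)
    next
      case False
      have "\<psi> (l * x) \<le> \<Psi> (l * x) + C"
        using Suc l by (intro Suc.IH) (auto simp: mult_ac)
      then show ?thesis using X0[of x] False X by linarith
    qed
  qed
  have "\<psi> x \<le> \<Psi> x + C" if x: "x > 0" for x
  proof -
    obtain n where "l ^ n < X / x"
      using real_arch_pow_inv[of "X / x" l] l X x by auto
    then show ?thesis using x by (intro claim[of x n]) (auto simp: field_simps)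
  qed
  then have "eventually (\<lambda>x. \<psi> x \<le> \<Psi> x + C) at_top"
    by (intro eventually_mono[OF eventually_gt_at_top[of 0]])
  then show ?thesis by (rule that)
qed

text \<open>The analytic data.  The vanishing of \<open>f\<close> on \<open>(0, 1)\<close>, which expresses that \<open>M\<close> is nonnegative, makes \<open>f\<^sup>*\<close> nonnegative
on the whole line; this matters because \<open>k\<^sup>*\<close> takes negative values near 0 when \<open>Q\<close> has an atom at 0.\<close>

locale conjugate_pair =
  fixes f k :: "real \<Rightarrow> real" and r \<alpha> :: real
  assumes rv_f: "f \<in> regularly_varying r" and rv_k: "k \<in> regularly_varying \<alpha>"
    and r: "r > 1" and \<alpha>: "\<alpha> > 1"
    and mono_f: "mono_on {0<..} f" and mono_k: "mono_on {0<..} k"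
    and nonneg_f: "\<And>z. z > 0 \<Longrightarrow> 0 \<le> f z" and nonneg_k: "\<And>z. z > 0 \<Longrightarrow> 0 \<le> k z"
    and f_small: "\<And>z. 0 < z \<Longrightarrow> z < 1 \<Longrightarrow> f z = 0"
begin

abbreviation "F \<equiv> convex_conj f"
abbreviation "K \<equiv> convex_conj k"

definition \<rho> :: real where "\<rho> = (r / (r - 1)) * (\<alpha> / (\<alpha> - 1))"
definition \<rho>' :: real where "\<rho>' = \<rho> / (\<rho> - 1)"
definition h :: "real \<Rightarrow> real" where "h = F \<circ> K"

lemma h_eq: "h z = F (K z)"
  by (simp add: h_def)

lemma superlinear_f: "superlinear f"
  by (rule rv_superlinear[OF rv_f r mono_f nonneg_f])

lemma superlinear_k: "superlinear k"
  by (rule rv_superlinear[OF rv_k \<alpha> mono_k nonneg_k])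

lemma \<rho>_gt_1: "\<rho> > 1"
proof -
  have "r / (r - 1) > 1" "\<alpha> / (\<alpha> - 1) > 1" using r \<alpha> by simp_all
  then show ?thesis unfolding \<rho>_def by (rule less_1_mult)
qed

lemma \<rho>'_gt_1: "\<rho>' > 1"
  using \<rho>_gt_1 by (simp add: \<rho>'_def)

text \<open>Letting \<open>z\<close> tend to 0 in \<open>x * z - f z = x * z\<close> gives the supremum at least 0.\<close>

lemma F_nonneg: "0 \<le> F x"
proof (rule ccontr)
  assume "\<not> 0 \<le> F x"
  then have neg: "F x < 0" by simp
  define z where "z = min (1 / 2) (- F x / (2 * (\<bar>x\<bar> + 1)))"
  have z: "z > 0" "z < 1" using neg by (auto simp: z_def field_simps)
  have "\<bar>x\<bar> * z \<le> \<bar>x\<bar> * (- F x / (2 * (\<bar>x\<bar> + 1)))"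
    by (intro mult_left_mono) (auto simp: z_def)
  also have "\<dots> = - F x * (\<bar>x\<bar> / (2 * (\<bar>x\<bar> + 1)))" by simp
  also have "\<dots> < - F x * 1" using neg by (intro mult_strict_left_mono) (auto simp: field_simps)
  finally have "\<bar>x\<bar> * z < - F x" by simp
  moreover have "- (\<bar>x\<bar> * z) \<le> x * z"
    using mult_right_mono[of "- \<bar>x\<bar>" x z] z by simp
  moreover have "x * z \<le> F x"
    using convex_conj_ge[OF superlinear_f z(1), of x] f_small[OF z] by simp
  ultimately show False by linarith
qed

lemma h_nonneg: "0 \<le> h x"
  by (simp add: h_eq F_nonneg)

lemma superlinear_F: "superlinear F"
  by (rule superlinearI) (auto intro: F_nonneg convex_conj_eventually_ge[OF superlinear_f])

lemma K_at_top: "filterlim K at_top at_top"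
  by (rule filterlim_at_top_mono[OF filterlim_ident])
     (use convex_conj_eventually_ge[OF superlinear_k, of 1] in simp)

lemma mono_F: "mono F" by (rule mono_convex_conj[OF superlinear_f])
lemma mono_K: "mono K" by (rule mono_convex_conj[OF superlinear_k])

lemma mono_h: "mono h"
  using mono_F mono_K by (auto simp: mono_def h_eq)

lemma rv_F: "F \<in> regularly_varying (r / (r - 1))"
  by (rule regularly_varying_convex_conj[OF rv_f r superlinear_f])

lemma rv_K: "K \<in> regularly_varying (\<alpha> / (\<alpha> - 1))"
  by (rule regularly_varying_convex_conj[OF rv_k \<alpha> superlinear_k])

lemma rv_h: "h \<in> regularly_varying \<rho>"
  unfolding h_def \<rho>_def
  by (rule regularly_varying_comp[OF rv_F mono_F _ rv_K mono_K K_at_top]) (use r in auto)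

lemma convex_h: "convex_on UNIV h"
proof (rule convex_onI)
  fix t x y :: real assume t: "0 < t" "t < 1"
  have "h ((1 - t) *\<^sub>R x + t *\<^sub>R y) \<le> F ((1 - t) *\<^sub>R K x + t *\<^sub>R K y)"
    using convex_onD[OF convex_on_convex_conj[OF superlinear_k], of t x y] t
    by (simp add: h_eq monoD[OF mono_F])
  also have "\<dots> \<le> (1 - t) * h x + t * h y"
    using convex_onD[OF convex_on_convex_conj[OF superlinear_f], of t "K x" "K y"] t
    by (simp add: h_eq)
  finally show "h ((1 - t) *\<^sub>R x + t *\<^sub>R y) \<le> (1 - t) * h x + t * h y" .
qed auto

lemma K_small_h: "eventually (\<lambda>z. C * K z \<le> h z) at_top"
  using eventually_compose_filterlim[OF superlinear_eventually[OF superlinear_F, of C] K_at_top]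
  by (simp add: h_eq)

lemma superlinear_h: "superlinear h"
proof (rule superlinearI)
  fix C :: real
  show "eventually (\<lambda>x. C * x \<le> h x) at_top"
    using K_small_h[of 1] convex_conj_eventually_ge[OF superlinear_k, of C]
    by eventually_elim simp
qed (rule h_nonneg)

lemma rv_h_conj: "convex_conj h \<in> regularly_varying \<rho>'"
  unfolding \<rho>'_def by (rule regularly_varying_convex_conj[OF rv_h \<rho>_gt_1 superlinear_h])

text \<open>Small perturbations of the arguments inside \<open>h = F \<circ> K\<close> are absorbed by an arbitrarily small factor in front;
the exponent in the choice of \<open>\<theta>\<close> adds up the indices, with one unit of slack at each application.\<close>

lemma inflated_h_bound:
  assumes c: "c > 1"
  obtains \<theta> where "1 < \<theta>" "\<theta> \<le> c" "eventually (\<lambda>z. F (\<theta> * K (\<theta> * z)) \<le> c * h z) at_top"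
proof -
  define a where "a = r / (r - 1)"
  define b where "b = \<alpha> / (\<alpha> - 1)"
  have a: "a > 1" and b: "b > 1" using r \<alpha> by (auto simp: a_def b_def)
  define \<theta> where "\<theta> = c powr (1 / ((b + 2) * a + 1))"
  have q: "(b + 2) * a + 1 > 1" using a b by simp
  then have th: "\<theta> > 1" using c by (simp add: \<theta>_def)
  have "\<theta> \<le> c powr 1" unfolding \<theta>_def using c q by (intro powr_mono) (auto simp: field_simps)
  then have thc: "\<theta> \<le> c" using c by simp
  have c_eq: "c = \<theta> powr ((b + 2) * a + 1)" using c q by (simp add: \<theta>_def powr_powr)
  have "\<theta> powr b < \<theta> powr (b + 1)" using th by simp
  with rv_upper[OF rv_K, of \<theta> "\<theta> powr (b + 1)"] th
  have "eventually (\<lambda>z. K (\<theta> * z) \<le> \<theta> powr (b + 1) * K z) at_top" by (simp add: b_def)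
  moreover have "(\<theta> powr (b + 2)) powr a < c"
    unfolding c_eq powr_powr using th by (intro powr_less_mono) auto
  with rv_upper[OF rv_F, of "\<theta> powr (b + 2)" c] th
  have "eventually (\<lambda>y. F (\<theta> powr (b + 2) * y) \<le> c * F y) at_top" by (simp add: a_def)
  from eventually_compose_filterlim[OF this K_at_top]
  have "eventually (\<lambda>z. F (\<theta> powr (b + 2) * K z) \<le> c * F (K z)) at_top" .
  ultimately have "eventually (\<lambda>z. F (\<theta> * K (\<theta> * z)) \<le> c * h z) at_top"
  proof eventually_elim
    case (elim z)
    have "\<theta> * K (\<theta> * z) \<le> \<theta> * (\<theta> powr (b + 1) * K z)" using elim th by (intro mult_left_mono) auto
    also have "\<dots> = \<theta> powr (b + 2) * K z" using th powr_add[of \<theta> 1 "b + 1"] by (simp add: add_ac)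
    finally have "F (\<theta> * K (\<theta> * z)) \<le> F (\<theta> powr (b + 2) * K z)" by (rule monoD[OF mono_F])
    with elim show ?case by (simp add: h_eq)
  qed
  with th thc show ?thesis by (rule that)
qed

text \<open>With \<open>h p = c * X * p\<close> and near-maximisers \<open>y\<close> of \<open>p * y - k y\<close> and \<open>s\<close> of \<open>K p * s - f s\<close>, the terms \<open>K p\<close> cancel and
\<open>k y + f s / s\<close> is about \<open>p * y - h p / s = p * (y - c * X / s)\<close>.  The factor \<open>c\<close> on \<open>X\<close> pays for the
inexactness \<open>\<eta>\<close> of the maximisers and, since costs are nonnegative, forces the step length \<open>y - X / s\<close> to be positive.
Finally \<open>p\<close> is eliminated through \<open>(\<rho> - 1) * (c * X * p) = \<rho> * (c * X) * p - h p\<close>, which is at most the conjugate of \<open>h\<close>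
at \<open>\<rho> * (c * X)\<close>.\<close>

lemma near_optimal_step_aux:
  assumes c: "c > 1" and e: "e > 0"
  shows "eventually (\<lambda>X. \<exists>y s. 0 < y \<and> y \<le> e * X \<and> 1 < s \<and> X / s < y \<and>
      k y + f s / s \<le> (y - X / s) * convex_conj h (\<rho> * (c * X)) / ((\<rho> - 1) * X)) at_top"
proof -
  \<comment> \<open>small enough that \<open>1 + 2 * \<eta> < (1 - \<eta>) * c\<close> and \<open>1 + 2 * \<eta> \<le> c\<close>\<close>
  define \<eta> where "\<eta> = min (1 / 4) ((c - 1) / (2 * (c + 2)))"
  have eta: "\<eta> > 0" "\<eta> < 1 / 2" using c by (auto simp: \<eta>_def)
  have "\<eta> * (c + 2) \<le> (c - 1) / (2 * (c + 2)) * (c + 2)"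
    using c by (intro mult_right_mono) (auto simp: \<eta>_def)
  also have "\<dots> = (c - 1) / 2" using c by (simp add: field_simps)
  finally have eta_half: "\<eta> * (c + 2) \<le> (c - 1) / 2" .
  then have eta_c: "1 + 2 * \<eta> < (1 - \<eta>) * c" using c by (simp add: algebra_simps)
  have "2 * \<eta> \<le> \<eta> * (c + 2)" using eta c by simp
  also note eta_half
  finally have eta_c': "1 + 2 * \<eta> \<le> c" using c by simp
  have "eventually (\<lambda>p. K (2 * p) \<le> 2 powr (\<alpha> / (\<alpha> - 1) + 1) * K p) at_top"
    by (rule rv_upper[OF rv_K]) auto
  moreover have "eventually (\<lambda>p. (c / e * 2 powr (\<alpha> / (\<alpha> - 1) + 1)) * K p \<le> h p) at_top"
    by (rule K_small_h)
  moreover note K_small_h[of 2] rv_eventually_pos[OF rv_K] eventually_gt_at_top[of 0]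
  ultimately have "eventually (\<lambda>p. K (2 * p) \<le> e / c * h p \<and> 2 * K p \<le> h p \<and> K p > 0 \<and> p > 0) at_top"
  proof eventually_elim
    case (elim p)
    have "K (2 * p) = e / c * (c / e * K (2 * p))" using c e by simp
    also have "\<dots> \<le> e / c * (c / e * (2 powr (\<alpha> / (\<alpha> - 1) + 1) * K p))"
      using c e elim by (intro mult_left_mono) auto
    also have "\<dots> \<le> e / c * h p" using c e elim by (intro mult_left_mono) (auto simp: mult_ac)
    finally show ?case using elim by simp
  qed
  then obtain N where N: "\<And>p. p \<ge> N \<Longrightarrow> K (2 * p) \<le> e / c * h p \<and> 2 * K p \<le> h p \<and> K p > 0 \<and> p > 0"
    by (auto simp: eventually_at_top_linorder)
  have "N > 0" using N[of N] by simp
  have "eventually (\<lambda>X. \<exists>p\<ge>N. h p = (c * X) * p) at_top"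
    using eventually_compose_filterlim[OF eventually_tangent_point[OF convex_h superlinear_h \<open>N > 0\<close>]
      filterlim_mult_const_at_top[of c]] c by simp
  then show ?thesis using eventually_gt_at_top[of 0]
  proof eventually_elim
    case (elim X)
    then obtain p where p: "p \<ge> N" "h p = c * X * p" by auto
    note Np = N[OF p(1)]
    have p0: "p > 0" and Kp: "K p > 0" and hp: "h p > 0" using Np by auto
    have "(1 - \<eta>) * K p < K p" using eta Kp by simp
    then obtain y where y: "y > 0" "(1 - \<eta>) * K p < p * y - k y"
      by (rule convex_conj_approx)
    have "(1 - \<eta>) * h p < F (K p)" using eta hp by (simp add: h_eq)
    then obtain s where s: "s > 0" "(1 - \<eta>) * h p < K p * s - f s"
      by (rule convex_conj_approx)
    have "1 / 2 * h p \<le> (1 - \<eta>) * h p" using eta hp by (intro mult_right_mono) auto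
    then have "K p * 1 \<le> (1 - \<eta>) * h p" using Np by linarith
    also have "\<dots> < K p * s" using s nonneg_f[OF s(1)] by linarith
    finally have s1: "1 < s" using Kp by simp
    \<comment> \<open>comparison with the dual variable \<open>2 * p\<close> bounds the maximiser by \<open>K (2 * p) / p\<close>, which is negligible against \<open>X\<close>\<close>
    have "p * y < 2 * p * y - k y" using y eta Kp mult_pos_pos[of "1 - \<eta>" "K p"] by linarith
    also have "\<dots> \<le> K (2 * p)" using convex_conj_ge[OF superlinear_k y(1)] by simp
    also have "\<dots> \<le> e * X * p" using Np p c by simp
    finally have "y * p \<le> (e * X) * p" by (simp add: mult_ac)
    then have y_le: "y \<le> e * X" using p0 by simp
    define d where "d = y - X / s"
    have "(1 - \<eta>) * K p \<le> p * y" using y nonneg_k[OF y(1)] by linarith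
    moreover have "1 / 2 * K p \<le> (1 - \<eta>) * K p" using eta Kp by (intro mult_right_mono) auto
    ultimately have Kpy: "K p \<le> 2 * (p * y)" by linarith
    have "f s \<le> s * K p - (1 - \<eta>) * h p" using s by (simp add: mult_ac)
    then have fs: "f s / s \<le> K p - (1 - \<eta>) * c * (X * p / s)"
      using s p by (simp add: field_simps)
    have "(1 + 2 * \<eta>) * (X * p / s) < (1 - \<eta>) * c * (X * p / s)"
      using eta_c elim p0 s by (intro mult_strict_right_mono) auto
    moreover have "\<eta> * K p \<le> \<eta> * (2 * (p * y))" using Kpy eta by (intro mult_left_mono) auto
    moreover have "k y \<le> p * y - K p + \<eta> * K p" using y by (simp add: algebra_simps)
    ultimately have "k y + f s / s < p * y + 2 * \<eta> * (p * y) - (1 + 2 * \<eta>) * (X * p / s)"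
      using fs by linarith
    also have "\<dots> = (1 + 2 * \<eta>) * p * d" by (simp add: d_def algebra_simps)
    finally have cost: "k y + f s / s < (1 + 2 * \<eta>) * p * d" .
    moreover have "0 \<le> k y + f s / s" using nonneg_k nonneg_f y s by simp
    ultimately have "0 < (1 + 2 * \<eta>) * p * d" by linarith
    moreover have "0 < (1 + 2 * \<eta>) * p" using p0 eta by simp
    ultimately have d: "d > 0" by (rule zero_less_mult_pos)
    have "(\<rho> - 1) * (c * X * p) \<le> convex_conj h (\<rho> * (c * X))"
      using convex_conj_ge[OF superlinear_h p0, of "\<rho> * (c * X)"] p by (simp add: algebra_simps)
    then have "c * p \<le> convex_conj h (\<rho> * (c * X)) / ((\<rho> - 1) * X)"
      using elim \<rho>_gt_1 by (simp add: field_simps)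
    then have "(1 + 2 * \<eta>) * p \<le> convex_conj h (\<rho> * (c * X)) / ((\<rho> - 1) * X)"
      using mult_right_mono[OF eta_c', of p] p0 by linarith
    from mult_right_mono[OF this, of d] cost d
    have "k y + f s / s \<le> (y - X / s) * convex_conj h (\<rho> * (c * X)) / ((\<rho> - 1) * X)"
      by (simp add: d_def mult_ac)
    moreover have "X / s < y" using d by (simp add: d_def)
    ultimately show ?case using y(1) y_le s1 by blast
  qed
qed

lemma near_optimal_step:
  assumes c: "c > 1" and e: "e > 0"
  shows "eventually (\<lambda>X. \<exists>y s. 0 < y \<and> y \<le> e * X \<and> 1 < s \<and> X / s < y \<and>
      k y + f s / s \<le> (y - X / s) * (c * convex_conj h (\<rho> * X)) / ((\<rho> - 1) * X)) at_top"
proof -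
  define c1 where "c1 = c powr (1 / (2 * \<rho>'))"
  have c1: "c1 > 1" using c \<rho>'_gt_1 by (simp add: c1_def)
  have "c1 powr \<rho>' = c powr (1 / 2)" using \<rho>'_gt_1 by (simp add: c1_def powr_powr)
  also have "\<dots> < c powr 1" using c by (intro powr_less_mono) auto
  finally have "c1 powr \<rho>' < c" using c by simp
  with c1 have "eventually (\<lambda>x. convex_conj h (c1 * x) \<le> c * convex_conj h x) at_top"
    by (intro rv_upper[OF rv_h_conj]) auto
  from eventually_compose_filterlim[OF this filterlim_mult_const_at_top[of \<rho>]] \<rho>_gt_1
  have "eventually (\<lambda>X. convex_conj h (c1 * (\<rho> * X)) \<le> c * convex_conj h (\<rho> * X)) at_top" by simp
  with near_optimal_step_aux[OF c1 e] eventually_gt_at_top[of 0] show ?thesis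
  proof eventually_elim
    case (elim X)
    from elim(1) obtain y s where ys: "0 < y" "y \<le> e * X" "1 < s" "X / s < y"
      "k y + f s / s \<le> (y - X / s) * convex_conj h (\<rho> * (c1 * X)) / ((\<rho> - 1) * X)" by blast
    note ys(5)
    also have "(y - X / s) * convex_conj h (\<rho> * (c1 * X)) / ((\<rho> - 1) * X)
        \<le> (y - X / s) * (c * convex_conj h (\<rho> * X)) / ((\<rho> - 1) * X)"
      using elim ys \<rho>_gt_1 by (intro divide_right_mono mult_left_mono) (auto simp: mult_ac)
    finally show ?case using ys by blast
  qed
qed

text \<open>The cost of a block is compared with the increment of \<open>\<Psi> x = c * h\<^sup>* (\<rho> * x) / \<rho>\<close>.  Writing \<open>H\<close> for \<open>h\<^sup>* (\<rho> * X)\<close>,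
the cost is about \<open>(1 - l) * H / (\<rho> - 1)\<close> and the increment about \<open>c * (1 - l powr \<rho>') * H / \<rho>\<close>; since
\<open>1 - l powr \<rho>'\<close> is about \<open>\<rho>' * (1 - l)\<close> for \<open>l\<close> near 1 and \<open>\<rho>' / \<rho> = 1 / (\<rho> - 1)\<close>, the factor \<open>c > 1\<close> leaves room for all errors.\<close>

lemma tail_exponent_upper:
  assumes mono: "mono \<psi>" and c: "c > 1"
    and step: "\<And>X y s l. 0 < l \<Longrightarrow> l < 1 \<Longrightarrow> 0 < y \<Longrightarrow> y \<le> l * X \<Longrightarrow> 1 < s \<Longrightarrow> X / s < y \<Longrightarrow>
        \<psi> X \<le> \<psi> (l * X) + ((1 - l) * X / (y - X / s) + 1) * (k y + f s / s)"
  obtains C where "eventually (\<lambda>x. \<psi> x \<le> c * convex_conj h (\<rho> * x) / \<rho> + C) at_top"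
proof -
  \<comment> \<open>one factor \<open>e\<close> each for the step cost, the convexity defect in \<open>l\<close>, the rounding step and regular variation\<close>
  define e where "e = c powr (1 / 4)"
  have e: "e > 1" using c by (simp add: e_def)
  have "e ^ 4 = e powr 4" using e by (simp add: powr_numeral)
  then have ce: "c = e ^ 4" using c by (simp add: e_def powr_powr)
  define l where "l = max (1 / 2) (e powr (- 1 / (\<rho>' - 1)))"
  have "e powr (- 1 / (\<rho>' - 1)) < e powr 0" using e \<rho>'_gt_1 by (intro powr_less_mono) auto
  then have l: "0 < l" "l < 1" using e by (auto simp: l_def)
  have "(e powr (- 1 / (\<rho>' - 1))) powr (\<rho>' - 1) \<le> l powr (\<rho>' - 1)"
    using \<rho>'_gt_1 by (intro powr_mono2) (auto simp: l_def)
  moreover have "- 1 / (\<rho>' - 1) * (\<rho>' - 1) = - 1" using \<rho>'_gt_1 by simp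
  ultimately have "e powr (- 1) \<le> l powr (\<rho>' - 1)" by (simp only: powr_powr)
  then have le: "1 / e \<le> l powr (\<rho>' - 1)" using e by (simp add: powr_minus_divide)
  define D where "D = 1 - l powr \<rho>'"
  have "\<rho>' * (1 / e) * (1 - l) \<le> \<rho>' * l powr (\<rho>' - 1) * (1 - l)"
    using le \<rho>'_gt_1 l by (intro mult_right_mono mult_left_mono) auto
  also have "\<dots> \<le> D" using powr_diff_lower_bound[OF l \<rho>'_gt_1] by (simp add: D_def)
  finally have D: "\<rho>' * (1 - l) \<le> e * D" using e by (simp add: field_simps)
  have D0: "D > 0" using l \<rho>'_gt_1 powr_less_mono2[of \<rho>' l 1] by (simp add: D_def)
  define \<epsilon> where "\<epsilon> = min l ((1 - l) * (e - 1))"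
  have "(1 - l) * (e - 1) > 0" using l e by simp
  then have \<epsilon>: "\<epsilon> > 0" "\<epsilon> \<le> l" using l by (auto simp: \<epsilon>_def)
  have "\<epsilon> \<le> (1 - l) * (e - 1)" by (simp add: \<epsilon>_def)
  then have \<epsilon>_le: "1 - l + \<epsilon> \<le> (1 - l) * e" by (simp add: algebra_simps)
  have ineq: "\<rho>' * e * (1 - l + \<epsilon>) \<le> c * (D / e)"
  proof -
    have "\<rho>' * e * (1 - l + \<epsilon>) \<le> \<rho>' * e * ((1 - l) * e)" using \<epsilon>_le \<rho>'_gt_1 e by (intro mult_left_mono) auto
    also have "\<dots> = e ^ 2 * (\<rho>' * (1 - l))" by (simp add: power2_eq_square)
    also have "\<dots> \<le> e ^ 2 * (e * D)" using D e by (intro mult_left_mono) auto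
    also have "\<dots> = c * (D / e)" using e by (simp add: ce power2_eq_square power4_eq_xxxx)
    finally show ?thesis .
  qed
  define \<Psi> where "\<Psi> x = c * convex_conj h (\<rho> * x) / \<rho>" for x
  have "D / e < D" using D0 e by (simp add: field_simps)
  then have "l powr \<rho>' < 1 - D / e" by (simp add: D_def)
  with l have "eventually (\<lambda>x. convex_conj h (l * x) \<le> (1 - D / e) * convex_conj h x) at_top"
    by (intro rv_upper[OF rv_h_conj]) auto
  from eventually_compose_filterlim[OF this filterlim_mult_const_at_top[of \<rho>]] \<rho>_gt_1
  have ev1: "eventually (\<lambda>X. convex_conj h (l * (\<rho> * X)) \<le> (1 - D / e) * convex_conj h (\<rho> * X)) at_top"
    by simp
  have ev2: "eventually (\<lambda>X. convex_conj h (\<rho> * X) > 0) at_top"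
    using eventually_compose_filterlim[OF rv_eventually_pos[OF rv_h_conj] filterlim_mult_const_at_top[of \<rho>]]
      \<rho>_gt_1 by simp
  have "eventually (\<lambda>x. \<psi> x - \<psi> (l * x) \<le> \<Psi> x - \<Psi> (l * x)) at_top"
    using near_optimal_step[OF e \<epsilon>(1)] ev1 ev2 eventually_gt_at_top[of 0]
  proof eventually_elim
    case (elim X)
    from elim(1) obtain y s where ys: "0 < y" "y \<le> \<epsilon> * X" "1 < s" "X / s < y"
      "k y + f s / s \<le> (y - X / s) * (e * convex_conj h (\<rho> * X)) / ((\<rho> - 1) * X)" by blast
    define d where "d = y - X / s"
    define H where "H = convex_conj h (\<rho> * X)"
    have H: "H > 0" using elim by (simp add: H_def)
    have X: "X > 0" by fact
    have d: "0 < d" "d \<le> \<epsilon> * X" using ys X by (auto simp: d_def intro: order_trans[rotated])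
    have "y \<le> l * X" using ys(2) \<epsilon> X mult_right_mono[of \<epsilon> l X] by linarith
    then have "\<psi> X - \<psi> (l * X) \<le> ((1 - l) * X / d + 1) * (k y + f s / s)"
      using step[OF l ys(1) _ ys(3,4)] by (simp add: d_def)
    also have "\<dots> \<le> ((1 - l) * X / d + 1) * (d * (e * H) / ((\<rho> - 1) * X))"
      using ys l d X by (intro mult_left_mono) (auto simp: d_def H_def)
    also have "\<dots> = (((1 - l) * X / d + 1) * d) * ((e * H) / ((\<rho> - 1) * X))"
      by simp
    also have "((1 - l) * X / d + 1) * d = (1 - l) * X + d"
      using d by (simp add: field_simps)
    also have "((1 - l) * X + d) * ((e * H) / ((\<rho> - 1) * X)) \<le> ((1 - l) * X + \<epsilon> * X) * ((e * H) / ((\<rho> - 1) * X))"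
      using d e H X \<rho>_gt_1 by (intro mult_right_mono) auto
    also have "(1 - l) * X + \<epsilon> * X = X * (1 - l + \<epsilon>)" by (simp add: algebra_simps)
    also have "X * (1 - l + \<epsilon>) * ((e * H) / ((\<rho> - 1) * X)) = (1 - l + \<epsilon>) * (e * H) / (\<rho> - 1)"
      using X by simp
    also have "\<dots> = \<rho>' * e * (1 - l + \<epsilon>) * (H / \<rho>)"
      using \<rho>_gt_1 by (simp add: \<rho>'_def)
    also have "\<dots> \<le> c * (D / e) * (H / \<rho>)"
      using ineq H \<rho>_gt_1 by (intro mult_right_mono) auto
    also have "\<dots> = c / \<rho> * (H - (1 - D / e) * H)" by (simp add: algebra_simps)
    also have "\<dots> \<le> c / \<rho> * (H - convex_conj h (\<rho> * (l * X)))"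
      using elim c \<rho>_gt_1 by (intro mult_left_mono) (auto simp: H_def mult_ac)
    also have "\<dots> = \<Psi> X - \<Psi> (l * X)" by (simp add: \<Psi>_def H_def algebra_simps)
    finally show ?case .
  qed
  moreover have "- c * h 1 / \<rho> \<le> \<Psi> x" if "x > 0" for x
  proof -
    have "- h 1 \<le> convex_conj h (\<rho> * x)"
      using convex_conj_ge[OF superlinear_h, of 1 "\<rho> * x"] that \<rho>_gt_1
      by (smt (verit) mult_pos_pos)
    then have "c * (- h 1) / \<rho> \<le> c * convex_conj h (\<rho> * x) / \<rho>"
      using c \<rho>_gt_1 by (intro divide_right_mono mult_left_mono) auto
    then show ?thesis by (simp add: \<Psi>_def)
  qed
  ultimately obtain C where "eventually (\<lambda>x. \<psi> x \<le> \<Psi> x + C) at_top"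
    using block_recursion_bound[OF mono l] by blast
  then show ?thesis using that by (simp add: \<Psi>_def)
qed

end

section \<open>Exponential moments\<close>

lemma (in prob_space) indep_var_nn_integral_mult:
  fixes \<phi> \<psi> :: "real \<Rightarrow> ennreal"
  assumes ind: "indep_var borel X borel Y"
    and [measurable]: "\<phi> \<in> borel_measurable borel" "\<psi> \<in> borel_measurable borel"
  shows "(\<integral>\<^sup>+\<omega>. \<phi> (X \<omega>) * \<psi> (Y \<omega>) \<partial>M) = (\<integral>\<^sup>+\<omega>. \<phi> (X \<omega>) \<partial>M) * (\<integral>\<^sup>+\<omega>. \<psi> (Y \<omega>) \<partial>M)"
proof -
  have [measurable]: "random_variable borel X" "random_variable borel Y"
    using ind by (auto dest: indep_var_rv1 indep_var_rv2)
  have eq: "distr M borel X \<Otimes>\<^sub>M distr M borel Y = distr M (borel \<Otimes>\<^sub>M borel) (\<lambda>\<omega>. (X \<omega>, Y \<omega>))"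
    using ind by (simp add: indep_var_distribution_eq)
  interpret Y: prob_space "distr M borel Y" by (rule prob_space_distr) simp
  have "(\<integral>\<^sup>+\<omega>. \<phi> (X \<omega>) * \<psi> (Y \<omega>) \<partial>M) = (\<integral>\<^sup>+p. \<phi> (fst p) * \<psi> (snd p) \<partial>distr M (borel \<Otimes>\<^sub>M borel) (\<lambda>\<omega>. (X \<omega>, Y \<omega>)))"
    by (subst nn_integral_distr) auto
  also have "\<dots> = (\<integral>\<^sup>+x. \<integral>\<^sup>+y. \<phi> x * \<psi> y \<partial>distr M borel Y \<partial>distr M borel X)"
    unfolding eq[symmetric] by (subst Y.nn_integral_fst[symmetric]) auto
  also have "\<dots> = (\<integral>\<^sup>+x. \<phi> x * (\<integral>\<^sup>+\<omega>. \<psi> (Y \<omega>) \<partial>M) \<partial>distr M borel X)"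
    by (subst nn_integral_cmult) (auto simp: nn_integral_distr)
  also have "\<dots> = (\<integral>\<^sup>+\<omega>. \<phi> (X \<omega>) \<partial>M) * (\<integral>\<^sup>+\<omega>. \<psi> (Y \<omega>) \<partial>M)"
    by (subst nn_integral_multc) (auto simp: nn_integral_distr)
  finally show ?thesis .
qed

text \<open>A discrete layer-cake bound: in the applications the sets \<open>A n\<close> are tail events, whose probabilities
decay fast enough to beat \<open>exp (b n)\<close> geometrically.\<close>

lemma (in prob_space) nn_integral_exp_layers:
  assumes X: "AE \<omega> in M. \<exists>n. \<omega> \<in> A n \<and> X \<omega> \<le> b n"
    and A: "\<And>n. A n \<in> events"
    and bound: "\<And>n. exp (b n) * prob (A n) \<le> C * x ^ n"
    and x: "0 \<le> x" "x < 1"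
  shows "(\<integral>\<^sup>+\<omega>. ennreal (exp (X \<omega>)) \<partial>M) \<le> ennreal (C / (1 - x))"
proof -
  have term_le_suminf: "u n \<le> suminf u" for u :: "nat \<Rightarrow> ennreal" and n
    using sum_le_suminf[of u "{n}"] by simp
  have "(\<integral>\<^sup>+\<omega>. ennreal (exp (X \<omega>)) \<partial>M)
      \<le> (\<integral>\<^sup>+\<omega>. (\<Sum>n. ennreal (exp (b n)) * indicator (A n) \<omega>) \<partial>M)"
  proof (rule nn_integral_mono_AE, use X in eventually_elim)
    fix \<omega> assume "\<exists>n. \<omega> \<in> A n \<and> X \<omega> \<le> b n"
    then obtain n where n: "\<omega> \<in> A n" "X \<omega> \<le> b n" by blast
    have "ennreal (exp (X \<omega>)) \<le> ennreal (exp (b n)) * indicator (A n) \<omega>"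
      using n by simp
    also have "\<dots> \<le> (\<Sum>n. ennreal (exp (b n)) * indicator (A n) \<omega>)"
      by (rule term_le_suminf)
    finally show "ennreal (exp (X \<omega>)) \<le> (\<Sum>n. ennreal (exp (b n)) * indicator (A n) \<omega>)" .
  qed
  also have "\<dots> = (\<Sum>n. \<integral>\<^sup>+\<omega>. ennreal (exp (b n)) * indicator (A n) \<omega> \<partial>M)"
    using A by (intro nn_integral_suminf) auto
  also have "\<dots> = (\<Sum>n. ennreal (exp (b n) * prob (A n)))"
    using A by (simp add: nn_integral_cmult_indicator emeasure_eq_measure ennreal_mult)
  also have "\<dots> \<le> (\<Sum>n. ennreal (C * x ^ n))"
    using bound by (intro suminf_le ennreal_leI) auto
  also have "\<dots> = ennreal (C / (1 - x))"
  proof (rule suminf_ennreal_eq)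
    have "0 \<le> exp (b 0) * prob (A 0)" by simp
    also have "\<dots> \<le> C" using bound[of 0] by simp
    finally show "0 \<le> C * x ^ n" for n using x by simp
    show "(\<lambda>n. C * x ^ n) sums (C / (1 - x))"
      using sums_mult[OF geometric_sums[of x], of C] x by simp
  qed
  finally show ?thesis .
qed

text \<open>Jensen's inequality for the concave function \<open>y \<mapsto> y powr a\<close>, obtained from convexity of \<open>exp\<close> between 0 and \<open>X \<omega>\<close>.\<close>

lemma (in prob_space) nn_integral_exp_scale:
  assumes [measurable]: "random_variable borel X"
    and le: "(\<integral>\<^sup>+\<omega>. ennreal (exp (X \<omega>)) \<partial>M) \<le> 1" and a: "0 \<le> a" "a \<le> 1"
  shows "(\<integral>\<^sup>+\<omega>. ennreal (exp (a * X \<omega>)) \<partial>M) \<le> 1"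
proof -
  have "(\<integral>\<^sup>+\<omega>. ennreal (exp (a * X \<omega>)) \<partial>M) \<le> (\<integral>\<^sup>+\<omega>. ennreal (1 - a) + ennreal a * ennreal (exp (X \<omega>)) \<partial>M)"
  proof (rule nn_integral_mono)
    fix \<omega>
    have "convex_on UNIV (exp :: real \<Rightarrow> real)" by (rule exp_convex)
    from convex_onD[OF this a, of 0 "X \<omega>"]
    show "ennreal (exp (a * X \<omega>)) \<le> ennreal (1 - a) + ennreal a * ennreal (exp (X \<omega>))"
      using a by (simp flip: ennreal_mult ennreal_plus)
  qed
  also have "\<dots> = ennreal (1 - a) + ennreal a * (\<integral>\<^sup>+\<omega>. ennreal (exp (X \<omega>)) \<partial>M)"
    by (subst nn_integral_add) (auto simp: nn_integral_cmult emeasure_space_1)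
  also have "\<dots> \<le> ennreal (1 - a) + ennreal a * 1" using le by (intro add_mono mult_left_mono) auto
  also have "\<dots> = 1" using a by (simp flip: ennreal_plus)
  finally show ?thesis .
qed

section \<open>Convergence of the iterates to the perpetuity\<close>

locale perpetuity_law = P: prob_space P + S: prob_space S
  for P :: "'a measure" and S :: "'b measure" +
  fixes M Q :: "'a \<Rightarrow> real" and R :: "'b \<Rightarrow> real"
  assumes M_meas[measurable]: "M \<in> borel_measurable P" and Q_meas[measurable]: "Q \<in> borel_measurable P"
    and M_range: "AE \<omega> in P. 0 \<le> M \<omega> \<and> M \<omega> < 1"
    and perp: "perpetuity P M Q S R"
begin

lemma R_meas[measurable]: "R \<in> borel_measurable S"
  using perp by (simp add: perpetuity_def)

text \<open>The Markov operator of the chain \<open>x \<mapsto> M x + Q\<close>.\<close>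

definition transition :: "(real \<Rightarrow> real) \<Rightarrow> real \<Rightarrow> real" where
  "transition g x = (\<integral>\<omega>. g (M \<omega> * x + Q \<omega>) \<partial>P)"

lemma integral_affine_distr:
  assumes N: "prob_space N" and [measurable]: "X \<in> borel_measurable N" "g \<in> borel_measurable borel"
    and g: "\<And>y. \<bar>g y\<bar> \<le> 1"
  shows "(\<integral>y. g y \<partial>distr (P \<Otimes>\<^sub>M N) borel (\<lambda>(\<omega>, \<sigma>). M \<omega> * X \<sigma> + Q \<omega>)) = (\<integral>\<sigma>. transition g (X \<sigma>) \<partial>N)"
proof -
  interpret N: prob_space N by (rule N)
  interpret PN: pair_prob_space P N ..
  have "(\<integral>y. g y \<partial>distr (P \<Otimes>\<^sub>M N) borel (\<lambda>(\<omega>, \<sigma>). M \<omega> * X \<sigma> + Q \<omega>))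
      = (\<integral>p. g (case p of (\<omega>, \<sigma>) \<Rightarrow> M \<omega> * X \<sigma> + Q \<omega>) \<partial>(P \<Otimes>\<^sub>M N))"
    by (rule integral_distr) auto
  also have "\<dots> = (\<integral>(\<omega>, \<sigma>). g (M \<omega> * X \<sigma> + Q \<omega>) \<partial>(P \<Otimes>\<^sub>M N))"
    by (intro Bochner_Integration.integral_cong) auto
  also have "\<dots> = (\<integral>\<sigma>. transition g (X \<sigma>) \<partial>N)"
    unfolding transition_def
  proof (rule PN.integral_snd[symmetric])
    show "integrable (P \<Otimes>\<^sub>M N) (\<lambda>(\<omega>, \<sigma>). g (M \<omega> * X \<sigma> + Q \<omega>))"
      by (rule PN.P.integrable_const_bound[where B = 1]) (auto simp: g split_beta')
  qed
  finally show ?thesis .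
qed

text \<open>The law of the chain started at 0 after \<open>n\<close> steps, as iterated push-forward along independent copies of \<open>(M, Q)\<close>.\<close>

primrec iterate_law :: "nat \<Rightarrow> real measure" where
  "iterate_law 0 = return borel 0"
| "iterate_law (Suc n) = distr (P \<Otimes>\<^sub>M iterate_law n) borel (\<lambda>(\<omega>, x). M \<omega> * x + Q \<omega>)"

lemma sets_iterate_law[measurable_cong, simp]: "sets (iterate_law n) = sets borel"
  by (cases n) auto

lemma prob_space_iterate_law: "prob_space (iterate_law n)"
proof (induction n)
  case 0
  then show ?case by (auto intro: prob_space_return)
next
  case (Suc n)
  then interpret N: prob_space "iterate_law n" .
  interpret PN: pair_prob_space P "iterate_law n" ..
  show ?case by (auto intro!: PN.P.prob_space_distr)
qed

text \<open>Lipschitz functions with values in \<open>[0, 1]\<close>: the transition operator preserves them and contracts the Lipschitz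
constant by \<open>E M\<close>.\<close>

definition test_fun :: "real \<Rightarrow> (real \<Rightarrow> real) \<Rightarrow> bool" where
  "test_fun L g \<longleftrightarrow> (\<forall>x. 0 \<le> g x \<and> g x \<le> 1) \<and> (\<forall>x y. \<bar>g x - g y\<bar> \<le> L * \<bar>x - y\<bar>)"

lemma test_fun_measurable: 
  assumes "test_fun L g" shows "g \<in> borel_measurable borel"
proof -
  have L: "0 \<le> L" using assms[unfolded test_fun_def, THEN conjunct2, rule_format, of 0 1] by simp
  have "L-lipschitz_on UNIV g"
    using assms L by (intro lipschitz_onI) (auto simp: test_fun_def dist_real_def)
  then show ?thesis
    by (intro borel_measurable_continuous_onI lipschitz_on_continuous_on)
qed

definition contraction :: real where "contraction = (\<integral>\<omega>. M \<omega> \<partial>P)"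

lemma integrable_M: "integrable P M"
  by (rule P.integrable_const_bound[where B = 1]) (use M_range in auto)

lemma contraction_bounds: "0 \<le> contraction" "contraction < 1"
proof -
  show "0 \<le> contraction" unfolding contraction_def
    by (rule integral_nonneg_AE) (use M_range in auto)
  have "(\<integral>\<omega>. M \<omega> \<partial>P) < (\<integral>\<omega>. 1 \<partial>P)"
    by (rule P.integral_less_AE_space) (use M_range integrable_M P.emeasure_space_1 in auto)
  then show "contraction < 1" by (simp add: contraction_def P.prob_space)
qed

lemma test_fun_transition:
  assumes g: "test_fun L g" shows "test_fun (contraction * L) (transition g)"
proof -
  note [measurable] = test_fun_measurable[OF g]
  have int: "integrable P (\<lambda>\<omega>. g (M \<omega> * x + Q \<omega>))" for x
    by (rule P.integrable_const_bound[where B = 1]) (use g in \<open>auto simp: test_fun_def\<close>)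
  have "transition g x \<le> (\<integral>\<omega>. 1 \<partial>P)" for x
    unfolding transition_def using g int by (intro integral_mono) (auto simp: test_fun_def)
  moreover have "0 \<le> transition g x" for x
    unfolding transition_def using g by (intro Bochner_Integration.integral_nonneg) (auto simp: test_fun_def)
  moreover have "\<bar>transition g x - transition g y\<bar> \<le> contraction * L * \<bar>x - y\<bar>" for x y
  proof -
    have "\<bar>transition g x - transition g y\<bar> = \<bar>\<integral>\<omega>. g (M \<omega> * x + Q \<omega>) - g (M \<omega> * y + Q \<omega>) \<partial>P\<bar>"
      unfolding transition_def using int by simp
    also have "\<dots> \<le> (\<integral>\<omega>. \<bar>g (M \<omega> * x + Q \<omega>) - g (M \<omega> * y + Q \<omega>)\<bar> \<partial>P)"
      by (rule integral_abs_bound)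
    also have "\<dots> \<le> (\<integral>\<omega>. M \<omega> * (L * \<bar>x - y\<bar>) \<partial>P)"
    proof (rule integral_mono_AE)
      show "AE \<omega> in P. \<bar>g (M \<omega> * x + Q \<omega>) - g (M \<omega> * y + Q \<omega>)\<bar> \<le> M \<omega> * (L * \<bar>x - y\<bar>)"
        using M_range
      proof eventually_elim
        case (elim \<omega>)
        have "\<bar>g (M \<omega> * x + Q \<omega>) - g (M \<omega> * y + Q \<omega>)\<bar> \<le> L * \<bar>(M \<omega> * x + Q \<omega>) - (M \<omega> * y + Q \<omega>)\<bar>"
          using g unfolding test_fun_def by blast
        also have "\<bar>(M \<omega> * x + Q \<omega>) - (M \<omega> * y + Q \<omega>)\<bar> = M \<omega> * \<bar>x - y\<bar>"
          using elim by (simp add: abs_mult flip: right_diff_distrib)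
        finally show ?case by (simp add: mult_ac)
      qed
    qed (use int integrable_M in auto)
    also have "\<dots> = contraction * L * \<bar>x - y\<bar>" by (simp add: contraction_def)
    finally show ?thesis .
  qed
  ultimately show ?thesis by (simp add: test_fun_def P.prob_space)
qed

lemma test_fun_transition_iterate:
  assumes "test_fun L g" shows "test_fun (contraction ^ n * L) ((transition ^^ n) g)"
  by (induction n) (use assms in \<open>auto dest: test_fun_transition simp: mult_ac\<close>)

lemma integral_R_transition:
  assumes g: "test_fun L g"
  shows "(\<integral>\<sigma>. (transition ^^ n) g (R \<sigma>) \<partial>S) = (\<integral>\<sigma>. g (R \<sigma>) \<partial>S)"
proof (induction n)
  case (Suc n)
  let ?g = "(transition ^^ n) g"
  have tf: "test_fun (contraction ^ n * L) ?g" by (rule test_fun_transition_iterate[OF g])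
  note [measurable] = test_fun_measurable[OF tf]
  have "(\<integral>\<sigma>. ?g (R \<sigma>) \<partial>S) = (\<integral>y. ?g y \<partial>distr S borel R)"
    by (subst integral_distr) auto
  also have "\<dots> = (\<integral>\<sigma>. transition ?g (R \<sigma>) \<partial>S)"
    using perp tf unfolding perpetuity_def
    by (auto intro!: integral_affine_distr simp: S.prob_space_axioms test_fun_def)
  finally show ?case using Suc by simp
qed simp

lemma integral_iterate_law:
  assumes g: "test_fun L g"
  shows "(\<integral>y. g y \<partial>iterate_law n) = (transition ^^ n) g 0"
  using g
proof (induction n arbitrary: L g)
  case 0
  then show ?case by (simp add: integral_return test_fun_measurable)
next
  case (Suc n)
  note [measurable] = test_fun_measurable[OF Suc.prems]
  have "(\<integral>y. g y \<partial>iterate_law (Suc n)) = (\<integral>y. transition g y \<partial>iterate_law n)"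
    using Suc.prems by (auto intro!: integral_affine_distr simp: prob_space_iterate_law test_fun_def)
  also have "\<dots> = (transition ^^ n) (transition g) 0" by (rule Suc.IH[OF test_fun_transition[OF Suc.prems]])
  finally show ?case by (simp add: funpow_swap1)
qed

text \<open>The law of \<open>R\<close> is invariant, so \<open>n\<close> applications of the transition operator leave \<open>E g(R)\<close> unchanged, while they
make the test function nearly constant and equal to its value at 0.\<close>

lemma iterate_law_converges:
  assumes g: "test_fun L g"
  shows "(\<lambda>n. \<integral>y. g y \<partial>iterate_law n) \<longlonglongrightarrow> (\<integral>\<sigma>. g (R \<sigma>) \<partial>S)"
proof -
  let ?g = "\<lambda>n. (transition ^^ n) g"
  have tf: "test_fun (contraction ^ n * L) (?g n)" for n by (rule test_fun_transition_iterate[OF g])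
  note [measurable] = test_fun_measurable[OF tf]
  have "(\<lambda>n. \<integral>\<sigma>. ?g n (R \<sigma>) - ?g n 0 \<partial>S) \<longlonglongrightarrow> (\<integral>\<sigma>. 0 \<partial>S)"
  proof (rule integral_dominated_convergence[where w = "\<lambda>_. 1"])
    show "AE \<sigma> in S. (\<lambda>n. ?g n (R \<sigma>) - ?g n 0) \<longlonglongrightarrow> 0"
    proof (rule AE_I2)
      fix \<sigma>
      have "(\<lambda>n. contraction ^ n * (L * \<bar>R \<sigma>\<bar>)) \<longlonglongrightarrow> 0"
        using contraction_bounds by (intro tendsto_mult_left_zero LIMSEQ_realpow_zero)
      then show "(\<lambda>n. ?g n (R \<sigma>) - ?g n 0) \<longlonglongrightarrow> 0"
        by (rule Lim_null_comparison[rotated])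
           (use tf in \<open>auto simp: test_fun_def mult.assoc intro!: always_eventually\<close>,
            metis diff_zero mult.assoc)
    qed
    show "AE \<sigma> in S. norm (?g n (R \<sigma>) - ?g n 0) \<le> 1" for n
      using tf[of n] unfolding test_fun_def by (intro AE_I2) (smt (verit) real_norm_def)
  qed auto
  moreover have "(\<integral>\<sigma>. ?g n (R \<sigma>) - ?g n 0 \<partial>S) = (\<integral>\<sigma>. g (R \<sigma>) \<partial>S) - (\<integral>y. g y \<partial>iterate_law n)" for n
  proof -
    have "integrable S (\<lambda>\<sigma>. ?g n (R \<sigma>))"
      by (rule S.integrable_const_bound[where B = 1]) (use tf[of n] in \<open>auto simp: test_fun_def\<close>)
    then show ?thesis
      by (simp add: integral_R_transition[OF g] integral_iterate_law[OF g] S.prob_space)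
  qed
  ultimately have "(\<lambda>n. (\<integral>\<sigma>. g (R \<sigma>) \<partial>S) - (\<integral>y. g y \<partial>iterate_law n)) \<longlonglongrightarrow> 0" by simp
  from tendsto_diff[OF tendsto_const[of "\<integral>\<sigma>. g (R \<sigma>) \<partial>S"] this] show ?thesis by simp
qed

text \<open>Conditioning on \<open>(M, Q)\<close> turns the moment generating function at \<open>z\<close> after a step into the previous one at \<open>z * M\<close>,
so a supersolution propagates by induction on \<open>n\<close> simultaneously for all \<open>z\<close>.\<close>

lemma exponential_supersolution:
  assumes [measurable]: "\<Lambda> \<in> borel_measurable borel"
    and nonneg: "\<And>z. z \<ge> 0 \<Longrightarrow> 0 \<le> \<Lambda> z"
    and super: "\<And>z. z \<ge> 0 \<Longrightarrow> (\<integral>\<^sup>+\<omega>. ennreal (exp (z * Q \<omega> + \<Lambda> (z * M \<omega>))) \<partial>P) \<le> ennreal (exp (\<Lambda> z))"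
    and z: "z \<ge> 0"
  shows "(\<integral>\<^sup>+x. ennreal (exp (z * x)) \<partial>iterate_law n) \<le> ennreal (exp (\<Lambda> z))"
  using z
proof (induction n arbitrary: z)
  case 0
  then show ?case using nonneg[of z] by (simp add: nn_integral_return)
next
  case (Suc n)
  interpret N: prob_space "iterate_law n" by (rule prob_space_iterate_law)
  have "(\<integral>\<^sup>+x. ennreal (exp (z * x)) \<partial>iterate_law (Suc n))
      = (\<integral>\<^sup>+p. ennreal (exp (z * (M (fst p) * snd p + Q (fst p)))) \<partial>(P \<Otimes>\<^sub>M iterate_law n))"
    by (simp add: nn_integral_distr split_beta')
  also have "\<dots> = (\<integral>\<^sup>+\<omega>. \<integral>\<^sup>+x. ennreal (exp (z * (M \<omega> * x + Q \<omega>))) \<partial>iterate_law n \<partial>P)"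
    by (subst N.nn_integral_fst[symmetric]) auto
  also have "\<dots> \<le> (\<integral>\<^sup>+\<omega>. ennreal (exp (z * Q \<omega> + \<Lambda> (z * M \<omega>))) \<partial>P)"
  proof (rule nn_integral_mono_AE)
    show "AE \<omega> in P. (\<integral>\<^sup>+x. ennreal (exp (z * (M \<omega> * x + Q \<omega>))) \<partial>iterate_law n)
        \<le> ennreal (exp (z * Q \<omega> + \<Lambda> (z * M \<omega>)))"
      using M_range
    proof eventually_elim
      case (elim \<omega>)
      have "(\<integral>\<^sup>+x. ennreal (exp (z * (M \<omega> * x + Q \<omega>))) \<partial>iterate_law n)
          = (\<integral>\<^sup>+x. ennreal (exp (z * Q \<omega>)) * ennreal (exp (z * M \<omega> * x)) \<partial>iterate_law n)"
        by (intro nn_integral_cong) (simp add: algebra_simps exp_add flip: ennreal_mult)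
      also have "\<dots> = ennreal (exp (z * Q \<omega>)) * (\<integral>\<^sup>+x. ennreal (exp (z * M \<omega> * x)) \<partial>iterate_law n)"
        by (rule nn_integral_cmult) measurable
      also have "\<dots> \<le> ennreal (exp (z * Q \<omega>)) * ennreal (exp (\<Lambda> (z * M \<omega>)))"
        using elim Suc.prems by (intro mult_left_mono Suc.IH) auto
      also have "\<dots> = ennreal (exp (z * Q \<omega> + \<Lambda> (z * M \<omega>)))"
        by (simp add: exp_add flip: ennreal_mult)
      finally show ?case .
    qed
  qed
  also have "\<dots> \<le> ennreal (exp (\<Lambda> z))" by (rule super[OF Suc.prems])
  finally show ?case .
qed

text \<open>The truncated exponential lies between the indicator of \<open>{y. y > x}\<close> and the exponential used in Chernoff's
inequality, and it is Lipschitz.\<close>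

lemma test_fun_truncated_exp:
  assumes z: "z \<ge> 0" shows "test_fun z (\<lambda>y. min 1 (exp (z * (y - x))))"
proof -
  have aux: "\<bar>min 1 (exp a) - min 1 (exp b)\<bar> \<le> \<bar>a - b\<bar>" for a b :: real
  proof -
    have *: "min 1 (exp b) - min 1 (exp a) \<le> b - a" if "a \<le> b" for a b :: real
    proof (cases "a \<ge> 0")
      case True
      then show ?thesis using that by (auto simp: min_def)
    next
      case False
      define m where "m = min b 0"
      have m: "a \<le> m" "m \<le> 0" "m \<le> b" using False that by (auto simp: m_def)
      have "exp m - exp a = exp m * (1 - exp (a - m))"
        by (simp add: right_diff_distrib flip: exp_add)
      also have "1 - exp (a - m) \<le> m - a"
        using exp_ge_add_one_self[of "a - m"] by linarith
      then have "exp m * (1 - exp (a - m)) \<le> 1 * (m - a)"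
        using m by (intro mult_mono) auto
      finally have "exp m - exp a \<le> m - a" by simp
      moreover have "min 1 (exp b) = exp m" "min 1 (exp a) = exp a"
        using False by (auto simp: m_def min_def)
      ultimately show ?thesis using m by simp
    qed
    have mono: "min 1 (exp a) \<le> min 1 (exp b)" if "a \<le> b" for a b :: real
      using that by (auto simp: min_def) 
    show ?thesis using *[of a b] *[of b a] mono[of a b] mono[of b a] by linarith
  qed
  have "\<bar>z * (u - x) - z * (v - x)\<bar> = z * \<bar>u - v\<bar>" for u v
    using z by (simp add: abs_mult flip: right_diff_distrib)
  with aux[of "z * (u - x)" "z * (v - x)" for u v] show ?thesis
    by (auto simp: test_fun_def)
qed

lemma tail_le_exponential:
  assumes [measurable]: "\<Lambda> \<in> borel_measurable borel"
    and nonneg: "\<And>z. z \<ge> 0 \<Longrightarrow> 0 \<le> \<Lambda> z"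
    and super: "\<And>z. z \<ge> 0 \<Longrightarrow> (\<integral>\<^sup>+\<omega>. ennreal (exp (z * Q \<omega> + \<Lambda> (z * M \<omega>))) \<partial>P) \<le> ennreal (exp (\<Lambda> z))"
    and z: "z \<ge> 0"
  shows "S.prob {\<sigma>\<in>space S. R \<sigma> > x} \<le> exp (\<Lambda> z - z * x)"
proof -
  define g where "g y = min 1 (exp (z * (y - x)))" for y :: real
  have g: "test_fun z g" unfolding g_def by (rule test_fun_truncated_exp[OF z])
  note [measurable] = test_fun_measurable[OF g]
  have "(\<integral>y. g y \<partial>iterate_law n) \<le> exp (\<Lambda> z - z * x)" for n
  proof -
    interpret N: prob_space "iterate_law n" by (rule prob_space_iterate_law)
    have "integrable (iterate_law n) g"
      by (rule N.integrable_const_bound[where B = 1]) (use g in \<open>auto simp: test_fun_def\<close>)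
    then have "ennreal (\<integral>y. g y \<partial>iterate_law n) = (\<integral>\<^sup>+y. ennreal (g y) \<partial>iterate_law n)"
      using g by (intro nn_integral_eq_integral[symmetric]) (auto simp: test_fun_def)
    also have "\<dots> \<le> (\<integral>\<^sup>+y. ennreal (exp (- (z * x))) * ennreal (exp (z * y)) \<partial>iterate_law n)"
    proof (rule nn_integral_mono)
      fix y
      have "exp (z * (y - x)) = exp (- (z * x)) * exp (z * y)"
        by (simp add: algebra_simps flip: exp_add)
      then show "ennreal (g y) \<le> ennreal (exp (- (z * x))) * ennreal (exp (z * y))"
        by (simp add: g_def flip: ennreal_mult)
    qed
    also have "\<dots> = ennreal (exp (- (z * x))) * (\<integral>\<^sup>+y. ennreal (exp (z * y)) \<partial>iterate_law n)"
      by (rule nn_integral_cmult) measurable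
    also have "\<dots> \<le> ennreal (exp (- (z * x))) * ennreal (exp (\<Lambda> z))"
      by (intro mult_left_mono exponential_supersolution[OF assms(1) nonneg super z]) auto
    also have "\<dots> = ennreal (exp (\<Lambda> z - z * x))"
      by (simp add: algebra_simps flip: ennreal_mult exp_add)
    finally show ?thesis by simp
  qed
  with iterate_law_converges[OF g] have le: "(\<integral>\<sigma>. g (R \<sigma>) \<partial>S) \<le> exp (\<Lambda> z - z * x)"
    by (intro LIMSEQ_le_const2) auto
  have "S.prob {\<sigma>\<in>space S. R \<sigma> > x} = (\<integral>\<sigma>. indicator {\<sigma>\<in>space S. R \<sigma> > x} \<sigma> \<partial>S)"
    by simp
  also have "\<dots> \<le> (\<integral>\<sigma>. g (R \<sigma>) \<partial>S)"
  proof (rule integral_mono)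
    show "integrable S (\<lambda>\<sigma>. g (R \<sigma>))"
      by (rule S.integrable_const_bound[where B = 1]) (use g in \<open>auto simp: test_fun_def\<close>)
    show "indicator {\<sigma>\<in>space S. R \<sigma> > x} \<sigma> \<le> g (R \<sigma>)" for \<sigma>
      using z by (auto simp: g_def indicator_def)
  qed (auto simp: integrable_indicator_iff S.emeasure_eq_measure)
  finally show ?thesis using le by linarith
qed

end

section \<open>Supersolutions for the moment generating function\<close>

locale light_tailed_perpetuity = conjugate_pair f k r \<alpha> + perpetuity_law P S M Q R
  for f k r \<alpha> and P :: "'a measure" and S :: "'b measure" and M Q R +
  assumes indep: "P.indep_var borel M borel Q"
    and tail_Q: "\<And>x. x > 0 \<Longrightarrow> P.prob {\<omega>\<in>space P. Q \<omega> > x} = exp (- k x)"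
    and tail_M: "\<And>x. x > 0 \<Longrightarrow> P.prob {\<omega>\<in>space P. M \<omega> > 1 - 1 / x} = exp (- f x / x)"
begin

text \<open>The definition of the conjugate reads \<open>P(Q > y) \<le> exp (K (\<theta> * z) - \<theta> * z * y)\<close>; the surplus \<open>\<theta> > 1\<close> makes the sum over
the layers \<open>y = n / z\<close> geometric.\<close>

lemma Q_exponential_moment:
  assumes \<theta>: "\<theta> > 1" and z: "z > 0" and K: "0 \<le> K (\<theta> * z)"
  shows "(\<integral>\<^sup>+\<omega>. ennreal (exp (z * Q \<omega>)) \<partial>P) \<le> ennreal (exp (1 + K (\<theta> * z)) / (1 - exp (1 - \<theta>)))"
proof -
  define A where "A n = (if n = 0 then space P else {\<omega>\<in>space P. Q \<omega> > real n / z})" for n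
  show ?thesis
  proof (rule P.nn_integral_exp_layers[where A = A and b = "\<lambda>n. real n + 1"])
    show "AE \<omega> in P. \<exists>n. \<omega> \<in> A n \<and> z * Q \<omega> \<le> real n + 1"
    proof (rule AE_I2)
      fix \<omega> assume w: "\<omega> \<in> space P"
      show "\<exists>n. \<omega> \<in> A n \<and> z * Q \<omega> \<le> real n + 1"
      proof (cases "z * Q \<omega> \<le> 1")
        case True
        then show ?thesis using w by (intro exI[of _ 0]) (simp add: A_def)
      next
        case False
        define n where "n = nat (\<lceil>z * Q \<omega>\<rceil> - 1)"
        have n: "n \<noteq> 0" "real n < z * Q \<omega>" "z * Q \<omega> \<le> real n + 1"
          using False unfolding n_def by linarith+
        then show ?thesis using w z by (intro exI[of _ n]) (auto simp: A_def field_simps)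
      qed
    qed
    show "A n \<in> P.events" for n by (simp add: A_def)
    show "exp (real n + 1) * P.prob (A n) \<le> exp (1 + K (\<theta> * z)) * exp (1 - \<theta>) ^ n" for n
    proof (cases "n = 0")
      case True
      then show ?thesis using K by (simp add: A_def P.prob_space)
    next
      case False
      then have n: "real n / z > 0" using z by simp
      have "\<theta> * z * (real n / z) - k (real n / z) \<le> K (\<theta> * z)"
        by (rule convex_conj_ge[OF superlinear_k n])
      then have "real n + 1 - k (real n / z) \<le> 1 + K (\<theta> * z) + real n * (1 - \<theta>)"
        using z by (simp add: algebra_simps)
      then have "exp (real n + 1 - k (real n / z)) \<le> exp (1 + K (\<theta> * z) + real n * (1 - \<theta>))" by simp
      also have "\<dots> = exp (1 + K (\<theta> * z)) * exp (1 - \<theta>) ^ n"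
        by (simp only: exp_add exp_of_nat_mult)
      also have "exp (real n + 1 - k (real n / z)) = exp (real n + 1) * P.prob (A n)"
        using False tail_Q[OF n] by (simp add: A_def flip: exp_add)
      finally show ?thesis .
    qed
    show "exp (1 - \<theta>) < 1" using \<theta> by simp
  qed simp
qed

text \<open>Taking \<open>1 / s\<close> as the distance of \<open>M\<close> from 1, the hypothesis \<open>F p \<le> w\<close> reads
\<open>P(1 - M < 1 / s) \<le> exp (w / s - p)\<close>; the surplus \<open>\<theta> > 1\<close> again makes the sum over layers geometric.\<close>

lemma M_laplace_bound:
  assumes \<theta>: "\<theta> > 1" and w: "w > 0" and p: "F p \<le> w"
  shows "(\<integral>\<^sup>+\<omega>. ennreal (exp (- (\<theta> * w * (1 - M \<omega>)))) \<partial>P) \<le> ennreal (exp (1 / \<theta> - p) / (1 - exp (1 / \<theta> - 1)))"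
proof -
  define s where "s n = \<theta> * w / (real n + 1)" for n
  have s: "s n > 0" for n using \<theta> w by (simp add: s_def)
  define A where "A n = {\<omega>\<in>space P. M \<omega> > 1 - 1 / s n}" for n
  show ?thesis
  proof (rule P.nn_integral_exp_layers[where A = A and b = "\<lambda>n. - real n"])
    show "AE \<omega> in P. \<exists>n. \<omega> \<in> A n \<and> - (\<theta> * w * (1 - M \<omega>)) \<le> - real n"
      using M_range AE_space
    proof eventually_elim
      case (elim \<omega>)
      define n where "n = nat \<lfloor>\<theta> * w * (1 - M \<omega>)\<rfloor>"
      have "0 \<le> \<theta> * w * (1 - M \<omega>)" using \<theta> w elim by simp
      then have n: "real n \<le> \<theta> * w * (1 - M \<omega>)" "\<theta> * w * (1 - M \<omega>) < real n + 1"
        unfolding n_def by linarith+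
      have "1 - M \<omega> < 1 / s n" using n(2) \<theta> w by (simp add: s_def field_simps)
      then show ?case using n(1) elim by (intro exI[of _ n]) (auto simp: A_def)
    qed
    show "A n \<in> P.events" for n by (simp add: A_def)
    show "exp (- real n) * P.prob (A n) \<le> exp (1 / \<theta> - p) * exp (1 / \<theta> - 1) ^ n" for n
    proof -
      have "p * s n - f (s n) \<le> w" using convex_conj_ge[OF superlinear_f s[of n], of p] p by linarith
      then have "- f (s n) / s n \<le> w / s n - p" using s[of n] by (simp add: field_simps)
      also have "w / s n = (real n + 1) / \<theta>" using \<theta> w by (simp add: s_def)
      finally have "- real n - f (s n) / s n \<le> 1 / \<theta> - p + real n * (1 / \<theta> - 1)"
        by (simp add: algebra_simps add_divide_distrib)
      then have "exp (- real n - f (s n) / s n) \<le> exp (1 / \<theta> - p + real n * (1 / \<theta> - 1))" by simp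
      also have "\<dots> = exp (1 / \<theta> - p) * exp (1 / \<theta> - 1) ^ n"
        by (simp only: exp_add exp_of_nat_mult)
      also have "exp (- real n - f (s n) / s n) = exp (- real n) * P.prob (A n)"
        using tail_M[OF s[of n]] by (simp add: A_def flip: exp_add)
      finally show ?thesis .
    qed
    show "exp (1 / \<theta> - 1) < 1" using \<theta> by simp
  qed simp
qed

text \<open>With \<open>u = K (\<theta> * z)\<close>, the factor from \<open>Q\<close> is of order \<open>exp u\<close>.  The increment of \<open>c * h / \<rho>\<close> is at least
\<open>t * min (1 - M) \<delta>\<close> with \<open>c1 = c powr (1 / 3)\<close> and \<open>t = c1\<^sup>2 * h z \<ge> \<theta> * F (\<theta> * u)\<close>, so the factor from \<open>M\<close> is of order
\<open>exp (- \<theta> * u) + exp (- t * \<delta>)\<close>, and \<open>t\<close> is much larger than \<open>u\<close>.  The product tends to 0, which leaves room for the constants.\<close>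

lemma supersolution_large:
  assumes c: "c > 1"
  shows "eventually (\<lambda>z. (\<integral>\<^sup>+\<omega>. ennreal (exp (z * Q \<omega> + c / \<rho> * (h (z * M \<omega>) - h z))) \<partial>P) \<le> 1) at_top"
proof -
  define c1 where "c1 = c powr (1 / 3)"
  have c1: "c1 > 1" using c by (simp add: c1_def)
  have "c1 ^ 3 = c1 powr 3" using c1 by (simp add: powr_numeral)
  then have cc: "c = c1 ^ 3" using c by (simp add: c1_def powr_powr)
  obtain \<delta> where \<delta>: "\<delta> > 0"
    and inc: "eventually (\<lambda>z. \<forall>m\<in>{0..1}. \<rho> / c1 * h z * min (1 - m) \<delta> \<le> h z - h (z * m)) at_top"
    using convex_rv_increment[OF convex_h mono_h rv_h \<rho>_gt_1 c1] by blast
  obtain \<theta> where \<theta>: "1 < \<theta>" "\<theta> \<le> c1" and infl: "eventually (\<lambda>z. F (\<theta> * K (\<theta> * z)) \<le> c1 * h z) at_top"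
    using inflated_h_bound[OF c1] by blast
  define C1 where "C1 = exp 1 / (1 - exp (1 - \<theta>))"
  define C2 where "C2 = exp (1 / \<theta>) / (1 - exp (1 / \<theta> - 1))"
  have C: "C1 > 0" "C2 > 0" using \<theta> by (auto simp: C1_def C2_def)
  have K\<theta>: "filterlim (\<lambda>z. K (\<theta> * z)) at_top at_top"
    using \<theta> by (intro filterlim_compose[OF K_at_top] filterlim_mult_const_at_top) auto
  have "((\<lambda>u. C1 * C2 * exp (- ((\<theta> - 1) * u)) + C1 * exp (- u)) \<longlongrightarrow> C1 * C2 * 0 + C1 * 0) at_top"
    using \<theta> by (intro tendsto_intros filterlim_compose[OF exp_at_bot]
        filterlim_compose[OF filterlim_uminus_at_bot_at_top] filterlim_mult_const_at_top filterlim_ident) auto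
  then have "eventually (\<lambda>u. C1 * C2 * exp (- ((\<theta> - 1) * u)) + C1 * exp (- u) < 1) at_top"
    by (rule order_tendstoD(2)) simp
  from eventually_compose_filterlim[OF this K\<theta>]
  have small: "eventually (\<lambda>z. C1 * C2 * exp (- ((\<theta> - 1) * K (\<theta> * z))) + C1 * exp (- K (\<theta> * z)) < 1) at_top" .
  have dom: "eventually (\<lambda>z. 2 / \<delta> * K (\<theta> * z) \<le> F (K (\<theta> * z))) at_top"
    by (rule eventually_compose_filterlim[OF superlinear_eventually[OF superlinear_F] K\<theta>])
  have Kpos: "eventually (\<lambda>z. 0 \<le> K (\<theta> * z)) at_top"
    using K\<theta> by (auto simp: filterlim_at_top)
  show ?thesis
    using inc infl small dom Kpos rv_eventually_pos[OF rv_h] eventually_gt_at_top[of 0]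
  proof eventually_elim
    case (elim z)
    define t where "t = c1 ^ 2 * h z"
    define w where "w = c1 * h z"
    define u where "u = K (\<theta> * z)"
    have u: "u \<ge> 0" and hz: "h z > 0" and z: "z > 0" using elim by (auto simp: u_def)
    have w: "w > 0" "F (\<theta> * u) \<le> w" using elim c1 by (auto simp: w_def u_def)
    have tw: "\<theta> * w \<le> t" using \<theta> hz c1 by (auto simp: t_def w_def power2_eq_square)
    have "F u \<le> F (\<theta> * u)" using u \<theta> by (intro monoD[OF mono_F]) (auto simp: mult_le_cancel_right1)
    also note w(2)
    also have "w \<le> t"
    proof -
      have "1 * w \<le> \<theta> * w" using \<theta> w by (intro mult_right_mono) auto
      then show ?thesis using tw by simp
    qed
    finally have "2 / \<delta> * u \<le> t" using elim by (simp add: u_def)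
    then have t\<delta>: "2 * u \<le> t * \<delta>" using \<delta> by (simp add: field_simps)
    have "(\<integral>\<^sup>+\<omega>. ennreal (exp (z * Q \<omega> + c / \<rho> * (h (z * M \<omega>) - h z))) \<partial>P)
        \<le> (\<integral>\<^sup>+\<omega>. (ennreal (exp (- (\<theta> * w * (1 - M \<omega>)))) + ennreal (exp (- (t * \<delta>)))) * ennreal (exp (z * Q \<omega>)) \<partial>P)"
    proof (rule nn_integral_mono_AE, use M_range in eventually_elim)
      fix \<omega> assume m: "0 \<le> M \<omega> \<and> M \<omega> < 1"
      have "\<rho> / c1 * h z * min (1 - M \<omega>) \<delta> \<le> h z - h (z * M \<omega>)"
        using elim m by auto
      then have "c / \<rho> * (\<rho> / c1 * h z * min (1 - M \<omega>) \<delta>) \<le> c / \<rho> * (h z - h (z * M \<omega>))"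
        using c \<rho>_gt_1 by (intro mult_left_mono) auto
      moreover have "c / \<rho> * (\<rho> / c1 * h z * min (1 - M \<omega>) \<delta>) = t * min (1 - M \<omega>) \<delta>"
        using c1 \<rho>_gt_1 by (simp add: t_def cc power3_eq_cube power2_eq_square)
      ultimately have "c / \<rho> * (h (z * M \<omega>) - h z) \<le> - (t * min (1 - M \<omega>) \<delta>)"
        by (simp add: algebra_simps)
      then have "exp (c / \<rho> * (h (z * M \<omega>) - h z)) \<le> exp (- (t * min (1 - M \<omega>) \<delta>))" by simp
      also have "\<dots> \<le> exp (- (\<theta> * w * (1 - M \<omega>))) + exp (- (t * \<delta>))"
      proof (cases "1 - M \<omega> \<le> \<delta>")
        case True
        have "\<theta> * w * (1 - M \<omega>) \<le> t * (1 - M \<omega>)" using tw m by (intro mult_right_mono) auto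
        then have "exp (- (t * (1 - M \<omega>))) \<le> exp (- (\<theta> * w * (1 - M \<omega>)))" by simp
        moreover have "min (1 - M \<omega>) \<delta> = 1 - M \<omega>" using True by simp
        ultimately show ?thesis using exp_ge_zero[of "- (t * \<delta>)"] by (simp only:)
      next
        case False
        then show ?thesis by (simp add: min_def)
      qed
      finally have "exp (c / \<rho> * (h (z * M \<omega>) - h z)) * exp (z * Q \<omega>)
          \<le> (exp (- (\<theta> * w * (1 - M \<omega>))) + exp (- (t * \<delta>))) * exp (z * Q \<omega>)"
        by (rule mult_right_mono) simp
      moreover have "exp (z * Q \<omega> + c / \<rho> * (h (z * M \<omega>) - h z))
          = exp (c / \<rho> * (h (z * M \<omega>) - h z)) * exp (z * Q \<omega>)"
        by (simp only: exp_add mult.commute)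
      ultimately show "ennreal (exp (z * Q \<omega> + c / \<rho> * (h (z * M \<omega>) - h z)))
        \<le> (ennreal (exp (- (\<theta> * w * (1 - M \<omega>)))) + ennreal (exp (- (t * \<delta>)))) * ennreal (exp (z * Q \<omega>))"
        by (simp flip: ennreal_mult ennreal_plus)
    qed
    also have "\<dots> = (\<integral>\<^sup>+\<omega>. ennreal (exp (- (\<theta> * w * (1 - M \<omega>)))) + ennreal (exp (- (t * \<delta>))) \<partial>P)
        * (\<integral>\<^sup>+\<omega>. ennreal (exp (z * Q \<omega>)) \<partial>P)"
      by (rule P.indep_var_nn_integral_mult[OF indep,
            of "\<lambda>m. ennreal (exp (- (\<theta> * w * (1 - m)))) + ennreal (exp (- (t * \<delta>)))" "\<lambda>q. ennreal (exp (z * q))"])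
         measurable
    also have "(\<integral>\<^sup>+\<omega>. ennreal (exp (- (\<theta> * w * (1 - M \<omega>)))) + ennreal (exp (- (t * \<delta>))) \<partial>P)
        = (\<integral>\<^sup>+\<omega>. ennreal (exp (- (\<theta> * w * (1 - M \<omega>)))) \<partial>P) + ennreal (exp (- (t * \<delta>)))"
      by (subst nn_integral_add) (auto simp: P.emeasure_space_1)
    also have "(\<dots>) * (\<integral>\<^sup>+\<omega>. ennreal (exp (z * Q \<omega>)) \<partial>P)
        \<le> (ennreal (C2 * exp (- (\<theta> * u))) + ennreal (exp (- (2 * u)))) * ennreal (C1 * exp u)"
    proof (intro mult_mono add_mono)
      show "(\<integral>\<^sup>+\<omega>. ennreal (exp (- (\<theta> * w * (1 - M \<omega>)))) \<partial>P) \<le> ennreal (C2 * exp (- (\<theta> * u)))"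
        using M_laplace_bound[OF \<theta>(1) w] by (simp add: C2_def exp_diff exp_minus field_simps)
      show "ennreal (exp (- (t * \<delta>))) \<le> ennreal (exp (- (2 * u)))" using t\<delta> by simp
      show "(\<integral>\<^sup>+\<omega>. ennreal (exp (z * Q \<omega>)) \<partial>P) \<le> ennreal (C1 * exp u)"
        using Q_exponential_moment[OF \<theta>(1) z] u by (simp add: C1_def u_def exp_add)
    qed auto
    also have "\<dots> = ennreal ((C2 * exp (- (\<theta> * u)) + exp (- (2 * u))) * (C1 * exp u))"
      using C by (simp flip: ennreal_mult ennreal_plus)
    also have "(C2 * exp (- (\<theta> * u)) + exp (- (2 * u))) * (C1 * exp u)
        = C1 * C2 * exp (- ((\<theta> - 1) * u)) + C1 * exp (- u)"
      by (simp add: algebra_simps flip: exp_add)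
    also have "ennreal \<dots> \<le> 1" using elim by (simp add: u_def)
    finally show ?case .
  qed
qed

text \<open>Beyond some \<open>z0\<close> the term \<open>c / \<rho> * h z\<close> suffices.  At \<open>z0\<close> itself, \<open>A\<close> is chosen such that
\<open>E exp (z0 * Q - A * z0 * (1 - M)) \<le> 1\<close>, which is possible because \<open>M < 1\<close> almost surely; Jensen's inequality carries this over to
all \<open>z \<le> z0\<close>.  In each regime the other one of the two terms in the exponent only helps, as both are increasing in \<open>z\<close>.\<close>

lemma supersolution_exists:
  assumes c: "c > 1"
  obtains A where "A \<ge> 0"
    "\<And>z. z \<ge> 0 \<Longrightarrow> (\<integral>\<^sup>+\<omega>. ennreal (exp (z * Q \<omega> + (A * (z * M \<omega>) + c / \<rho> * h (z * M \<omega>)))) \<partial>P)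
       \<le> ennreal (exp (A * z + c / \<rho> * h z))"
proof -
  have [measurable]: "h \<in> borel_measurable borel" by (rule borel_measurable_mono[OF mono_h])
  have "eventually (\<lambda>z. 0 \<le> K (2 * z)) at_top"
    using filterlim_compose[OF K_at_top filterlim_mult_const_at_top[of 2]] by (auto simp: filterlim_at_top)
  with supersolution_large[OF c] eventually_gt_at_top[of 0]
  have "eventually (\<lambda>z. (\<integral>\<^sup>+\<omega>. ennreal (exp (z * Q \<omega> + c / \<rho> * (h (z * M \<omega>) - h z))) \<partial>P) \<le> 1 \<and>
      z > 0 \<and> 0 \<le> K (2 * z)) at_top" by (simp add: eventually_conj_iff)
  then obtain z0 where z0: "\<And>z. z \<ge> z0 \<Longrightarrow>
      (\<integral>\<^sup>+\<omega>. ennreal (exp (z * Q \<omega> + c / \<rho> * (h (z * M \<omega>) - h z))) \<partial>P) \<le> 1 \<and> z > 0 \<and> 0 \<le> K (2 * z)"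
    by (auto simp: eventually_at_top_linorder)
  have z0_pos: "z0 > 0" and K0: "0 \<le> K (2 * z0)" using z0[of z0] by auto
  have fin: "(\<integral>\<^sup>+\<omega>. ennreal (exp (z0 * Q \<omega>)) \<partial>P) < \<infinity>"
    using Q_exponential_moment[of 2 z0] z0_pos K0 by (auto simp: order.strict_trans1)
  have "(\<lambda>n. \<integral>\<^sup>+\<omega>. ennreal (exp (z0 * Q \<omega> - real n * (z0 * (1 - M \<omega>)))) \<partial>P) \<longlonglongrightarrow> (\<integral>\<^sup>+\<omega>. 0 \<partial>P)"
  proof (rule nn_integral_dominated_convergence[where w = "\<lambda>\<omega>. ennreal (exp (z0 * Q \<omega>))"])
    show "AE \<omega> in P. ennreal (exp (z0 * Q \<omega> - real n * (z0 * (1 - M \<omega>)))) \<le> ennreal (exp (z0 * Q \<omega>))" for n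
      using M_range by eventually_elim (use z0_pos in simp)
    show "AE \<omega> in P. (\<lambda>n. ennreal (exp (z0 * Q \<omega> - real n * (z0 * (1 - M \<omega>))))) \<longlonglongrightarrow> 0"
      using M_range
    proof eventually_elim
      case (elim \<omega>)
      have "(\<lambda>n. exp (z0 * Q \<omega>) * exp (- (z0 * (1 - M \<omega>))) ^ n) \<longlonglongrightarrow> exp (z0 * Q \<omega>) * 0"
        using z0_pos elim by (intro tendsto_mult tendsto_const LIMSEQ_realpow_zero) auto
      then have "(\<lambda>n. exp (z0 * Q \<omega> - real n * (z0 * (1 - M \<omega>)))) \<longlonglongrightarrow> 0"
        by (simp add: exp_diff exp_minus exp_of_nat_mult divide_inverse power_inverse)
      then show ?case using tendsto_ennrealI by fastforce
    qed
  qed (use fin in auto)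
  then have "eventually (\<lambda>n. (\<integral>\<^sup>+\<omega>. ennreal (exp (z0 * Q \<omega> - real n * (z0 * (1 - M \<omega>)))) \<partial>P) < 1) sequentially"
    by (rule order_tendstoD(2)) simp
  then obtain n where n: "(\<integral>\<^sup>+\<omega>. ennreal (exp (z0 * Q \<omega> - real n * (z0 * (1 - M \<omega>)))) \<partial>P) \<le> 1"
    by (auto simp: eventually_sequentially intro: less_imp_le)
  define A where "A = real n"
  have small: "(\<integral>\<^sup>+\<omega>. ennreal (exp (z * Q \<omega> - A * (z * (1 - M \<omega>)))) \<partial>P) \<le> 1" if z: "0 \<le> z" "z \<le> z0" for z
  proof -
    have "(\<integral>\<^sup>+\<omega>. ennreal (exp (z / z0 * (z0 * Q \<omega> - A * (z0 * (1 - M \<omega>))))) \<partial>P) \<le> 1"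
      using n z z0_pos by (intro P.nn_integral_exp_scale) (auto simp: A_def)
    moreover have "z / z0 * (z0 * Q \<omega> - A * (z0 * (1 - M \<omega>))) = z * Q \<omega> - A * (z * (1 - M \<omega>))" for \<omega>
      using z0_pos by (simp add: field_simps)
    ultimately show ?thesis by simp
  qed
  \<comment> \<open>both regimes bound the integrand by \<open>exp (A * z + c / \<rho> * h z)\<close> times a random variable \<open>exp v\<close> of expectation at most 1\<close>
  have conclude: "(\<integral>\<^sup>+\<omega>. ennreal (exp (z * Q \<omega> + (A * (z * M \<omega>) + c / \<rho> * h (z * M \<omega>)))) \<partial>P)
       \<le> ennreal (exp (A * z + c / \<rho> * h z))"
    if [measurable]: "v \<in> borel_measurable P" and v: "(\<integral>\<^sup>+\<omega>. ennreal (exp (v \<omega>)) \<partial>P) \<le> 1"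
      and le: "AE \<omega> in P. z * Q \<omega> + (A * (z * M \<omega>) + c / \<rho> * h (z * M \<omega>)) \<le> A * z + c / \<rho> * h z + v \<omega>" for z v
  proof -
    have "(\<integral>\<^sup>+\<omega>. ennreal (exp (z * Q \<omega> + (A * (z * M \<omega>) + c / \<rho> * h (z * M \<omega>)))) \<partial>P)
        \<le> (\<integral>\<^sup>+\<omega>. ennreal (exp (A * z + c / \<rho> * h z)) * ennreal (exp (v \<omega>)) \<partial>P)"
      by (rule nn_integral_mono_AE, use le in eventually_elim) (simp flip: ennreal_mult exp_add)
    also have "\<dots> = ennreal (exp (A * z + c / \<rho> * h z)) * (\<integral>\<^sup>+\<omega>. ennreal (exp (v \<omega>)) \<partial>P)"
      by (rule nn_integral_cmult) measurable
    also have "\<dots> \<le> ennreal (exp (A * z + c / \<rho> * h z)) * 1" using v by (intro mult_left_mono) auto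
    finally show ?thesis by simp
  qed
  have c\<rho>: "0 \<le> c / \<rho>" using c \<rho>_gt_1 by simp
  have "(\<integral>\<^sup>+\<omega>. ennreal (exp (z * Q \<omega> + (A * (z * M \<omega>) + c / \<rho> * h (z * M \<omega>)))) \<partial>P)
       \<le> ennreal (exp (A * z + c / \<rho> * h z))" if z: "z \<ge> 0" for z
  proof (cases "z \<le> z0")
    case True
    show ?thesis
    proof (rule conclude[OF _ small[OF z True]])
      show "AE \<omega> in P. z * Q \<omega> + (A * (z * M \<omega>) + c / \<rho> * h (z * M \<omega>))
          \<le> A * z + c / \<rho> * h z + (z * Q \<omega> - A * (z * (1 - M \<omega>)))"
        using M_range
      proof eventually_elim
        case (elim \<omega>)
        have "z * M \<omega> \<le> z" using elim z by (simp add: mult_left_le)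
        then have "c / \<rho> * h (z * M \<omega>) \<le> c / \<rho> * h z"
          by (intro mult_left_mono[OF monoD[OF mono_h] c\<rho>])
        then show ?case by (simp add: algebra_simps)
      qed
    qed measurable
  next
    case False
    then have large: "(\<integral>\<^sup>+\<omega>. ennreal (exp (z * Q \<omega> + c / \<rho> * (h (z * M \<omega>) - h z))) \<partial>P) \<le> 1"
      using z0 by simp
    show ?thesis
    proof (rule conclude[OF _ large])
      show "AE \<omega> in P. z * Q \<omega> + (A * (z * M \<omega>) + c / \<rho> * h (z * M \<omega>))
          \<le> A * z + c / \<rho> * h z + (z * Q \<omega> + c / \<rho> * (h (z * M \<omega>) - h z))"
        using M_range
      proof eventually_elim
        case (elim \<omega>)
        have "A * (z * M \<omega>) \<le> A * z" using elim z by (intro mult_left_mono) (auto simp: mult_left_le A_def)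
        then show ?case by (simp add: algebra_simps)
      qed
    qed measurable
  qed
  then show ?thesis by (intro that[of A]) (auto simp: A_def)
qed

section \<open>The tail of the perpetuity\<close>

abbreviation tail :: "real \<Rightarrow> real" where "tail x \<equiv> S.prob {\<sigma>\<in>space S. R \<sigma> > x}"

lemma tail_antimono: "x \<le> y \<Longrightarrow> tail y \<le> tail x"
  by (intro S.finite_measure_mono) auto

text \<open>The fixed-point equation bounds \<open>P(R > x)\<close> below by the probability that \<open>(M, Q)\<close> lies in a favourable event and an
independent copy of \<open>R\<close> exceeds \<open>b\<close>.\<close>

lemma tail_recursion:
  assumes [measurable]: "A \<in> P.events"
    and A: "\<And>\<omega> v. \<omega> \<in> A \<Longrightarrow> v > b \<Longrightarrow> x < M \<omega> * v + Q \<omega>"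
  shows "P.prob A * tail b \<le> tail x"
proof -
  interpret PS: pair_prob_space P S ..
  have "tail x = measure (distr S borel R) {x<..}"
    by (subst measure_distr) (auto intro!: arg_cong[where f = S.prob])
  also have "\<dots> = measure (P \<Otimes>\<^sub>M S) ((\<lambda>(\<omega>, \<sigma>). M \<omega> * R \<sigma> + Q \<omega>) -` {x<..} \<inter> space (P \<Otimes>\<^sub>M S))"
    using perp unfolding perpetuity_def by (simp, subst measure_distr) auto
  also have "\<dots> \<ge> measure (P \<Otimes>\<^sub>M S) (A \<times> {\<sigma>\<in>space S. R \<sigma> > b})"
    using A sets.sets_into_space[OF assms(1)]
    by (intro PS.P.finite_measure_mono) (auto simp: space_pair_measure)
  also have "measure (P \<Otimes>\<^sub>M S) (A \<times> {\<sigma>\<in>space S. R \<sigma> > b}) = P.prob A * tail b"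
    by (simp add: measure_def S.emeasure_pair_measure_Times enn2real_mult)
  finally show ?thesis .
qed

text \<open>Since \<open>Q\<close> has unbounded support, a single large value of \<open>Q\<close> lifts \<open>R\<close> above \<open>x\<close> from any level
\<open>- n\<close> that \<open>R\<close> exceeds with positive probability.\<close>

lemma tail_pos: "tail x > 0"
proof -
  have "(\<lambda>n. tail (- real n)) \<longlonglongrightarrow> S.prob (\<Union>n. {\<sigma>\<in>space S. R \<sigma> > - real n})"
    by (rule S.finite_Lim_measure_incseq) (auto simp: incseq_def)
  also have "(\<Union>n. {\<sigma>\<in>space S. R \<sigma> > - real n}) = space S"
  proof -
    have "\<exists>n. - real n < R \<sigma>" for \<sigma>
      using reals_Archimedean2[of "- R \<sigma>"] by (metis minus_less_iff)
    then show ?thesis by auto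
  qed
  finally have "(\<lambda>n. tail (- real n)) \<longlonglongrightarrow> 1" by (simp add: S.prob_space)
  then have "eventually (\<lambda>n. tail (- real n) > 0) sequentially"
    by (rule order_tendstoD(1)) simp
  then obtain n where n: "tail (- real n) > 0" by (auto simp: eventually_sequentially)
  define y where "y = max 1 (x + real n)"
  have y: "y > 0" "y \<ge> x + real n" by (auto simp: y_def)
  define A where "A = {\<omega>\<in>space P. Q \<omega> > y \<and> 0 \<le> M \<omega> \<and> M \<omega> < 1}"
  have "P.prob A = P.prob {\<omega>\<in>space P. Q \<omega> > y}"
    unfolding A_def by (intro P.finite_measure_eq_AE) (use M_range in auto)
  then have "P.prob A > 0" using tail_Q[OF y(1)] by simp
  moreover have "P.prob A * tail (- real n) \<le> tail x"
  proof (rule tail_recursion)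
    fix \<omega> v assume w: "\<omega> \<in> A" "v > - real n"
    have "- real n \<le> M \<omega> * v"
    proof (cases "v \<ge> 0")
      case True
      then show ?thesis using w by (simp add: A_def order_trans[of _ 0])
    next
      case False
      then have "1 * v \<le> M \<omega> * v" using w by (intro mult_right_mono_neg) (auto simp: A_def)
      then show ?thesis using w by simp
    qed
    then show "x < M \<omega> * v + Q \<omega>" using w y by (simp add: A_def)
  qed (simp add: A_def)
  ultimately show ?thesis using n by (smt (verit) mult_pos_pos)
qed

definition \<psi> :: "real \<Rightarrow> real" where "\<psi> x = - ln (tail x)"

lemma mono_\<psi>: "mono \<psi>"
  unfolding mono_def \<psi>_def using tail_antimono tail_pos by simp

text \<open>Chernoff's bound with the supersolution, optimised over \<open>z\<close>; the conjugate of \<open>\<Lambda>\<close> is computed by scaling and shifting.\<close>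

lemma \<psi>_lower:
  assumes c: "c > 1"
  obtains A where "\<And>x. c / \<rho> * convex_conj h (\<rho> / c * (x - A)) \<le> \<psi> x"
proof -
  obtain A where A: "A \<ge> 0"
    "\<And>z. z \<ge> 0 \<Longrightarrow> (\<integral>\<^sup>+\<omega>. ennreal (exp (z * Q \<omega> + (A * (z * M \<omega>) + c / \<rho> * h (z * M \<omega>)))) \<partial>P)
       \<le> ennreal (exp (A * z + c / \<rho> * h z))"
    using supersolution_exists[OF c] by blast
  have c\<rho>: "0 < c / \<rho>" using c \<rho>_gt_1 by simp
  have [measurable]: "h \<in> borel_measurable borel" by (rule borel_measurable_mono[OF mono_h])
  have le: "z * x - (A * z + c / \<rho> * h z) \<le> \<psi> x" if "z \<ge> 0" for x z
  proof -
    have "tail x \<le> exp ((A * z + c / \<rho> * h z) - z * x)"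
    proof (rule tail_le_exponential[OF _ _ A(2) that])
      show "0 \<le> A * z + c / \<rho> * h z" if "z \<ge> 0" for z
        using A(1) that by (intro add_nonneg_nonneg mult_nonneg_nonneg less_imp_le[OF c\<rho>] h_nonneg)
    qed measurable
    then have "ln (tail x) \<le> A * z + c / \<rho> * h z - z * x"
      using tail_pos[of x] by (metis ln_exp ln_le_cancel_iff exp_gt_zero)
    then show ?thesis by (simp add: \<psi>_def)
  qed
  have "c / \<rho> * convex_conj h (\<rho> / c * (x - A)) \<le> \<psi> x" for x
  proof -
    have "convex_conj h (\<rho> / c * (x - A)) \<le> \<rho> / c * \<psi> x"
    proof (rule convex_conj_le)
      fix z :: real assume "z > 0"
      then have "\<rho> / c * (z * x - (A * z + c / \<rho> * h z)) \<le> \<rho> / c * \<psi> x"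
        using le[of z x] c \<rho>_gt_1 by (intro mult_left_mono) auto
      moreover have "\<rho> / c * (z * x - (A * z + c / \<rho> * h z)) = \<rho> / c * (x - A) * z - h z"
        using c \<rho>_gt_1 by (simp add: field_simps)
      ultimately show "\<rho> / c * (x - A) * z - h z \<le> \<rho> / c * \<psi> x" by simp
    qed
    then show ?thesis using c \<rho>_gt_1 by (simp add: field_simps)
  qed
  then show ?thesis by (rule that)
qed

text \<open>From any value above \<open>x - d\<close>, multiplication by \<open>M > 1 - 1 / s\<close> loses at most \<open>X / s\<close> as long as \<open>x - d \<le> X\<close>, and \<open>Q > y\<close>
gains \<open>y = d + X / s\<close>.\<close>

lemma \<psi>_single_step:
  assumes y: "y > 0" and s: "s > 1" and d: "d = y - X / s" "d > 0" and x: "d \<le> x" "x \<le> X"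
  shows "\<psi> x \<le> (k y + f s / s) + \<psi> (x - d)"
proof -
  define A where "A = {\<omega>\<in>space P. M \<omega> > 1 - 1 / s} \<inter> {\<omega>\<in>space P. Q \<omega> > y}"
  have "A = (\<lambda>\<omega>. (M \<omega>, Q \<omega>)) -` ({1 - 1 / s<..} \<times> {y<..}) \<inter> space P"
    by (auto simp: A_def)
  then have "P.prob A = P.prob (M -` {1 - 1 / s<..} \<inter> space P) * P.prob (Q -` {y<..} \<inter> space P)"
    using P.indep_varD[OF indep, of "{1 - 1 / s<..}" "{y<..}"] by simp
  also have "M -` {1 - 1 / s<..} \<inter> space P = {\<omega>\<in>space P. M \<omega> > 1 - 1 / s}" by auto
  also have "Q -` {y<..} \<inter> space P = {\<omega>\<in>space P. Q \<omega> > y}" by auto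
  also have "P.prob {\<omega>\<in>space P. M \<omega> > 1 - 1 / s} * P.prob {\<omega>\<in>space P. Q \<omega> > y} = exp (- f s / s) * exp (- k y)"
    using tail_M[of s] tail_Q[OF y] s by simp
  also have "\<dots> = exp (- (k y + f s / s))" by (simp flip: exp_add)
  finally have PA: "P.prob A = exp (- (k y + f s / s))" .
  have "P.prob A * tail (x - d) \<le> tail x"
  proof (rule tail_recursion)
    fix \<omega> v assume w: "\<omega> \<in> A" "x - d < v"
    have "x - d - X / s \<le> x - d - (x - d) / s"
      using s x d by (intro diff_left_mono divide_right_mono) auto
    also have "\<dots> = (1 - 1 / s) * (x - d)" using s by (simp add: field_simps)
    also have "\<dots> \<le> (1 - 1 / s) * v" using w s by (intro mult_left_mono) auto
    also have "\<dots> \<le> M \<omega> * v" using w x by (intro mult_right_mono) (auto simp: A_def)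
    finally have "x - d - X / s \<le> M \<omega> * v" .
    moreover have "y < Q \<omega>" using w by (simp add: A_def)
    ultimately show "x < M \<omega> * v + Q \<omega>" using d by linarith
  qed (simp add: A_def)
  then have "exp (- (k y + f s / s)) * tail (x - d) \<le> tail x" by (simp add: PA)
  then have "ln (exp (- (k y + f s / s)) * tail (x - d)) \<le> ln (tail x)"
    using tail_pos by simp
  then have "- (k y + f s / s) + ln (tail (x - d)) \<le> ln (tail x)"
    using tail_pos[of "x - d"] by (simp add: ln_mult)
  then show ?thesis by (simp add: \<psi>_def)
qed

text \<open>Descending from \<open>X\<close> to \<open>l * X\<close> in steps of length \<open>d = y - X / s\<close>; the additional step covers rounding.\<close>

lemma \<psi>_block:
  assumes l: "0 < l" "l < 1" and y: "0 < y" "y \<le> l * X" and s: "1 < s" "X / s < y"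
  shows "\<psi> X \<le> \<psi> (l * X) + ((1 - l) * X / (y - X / s) + 1) * (k y + f s / s)"
proof -
  define d where "d = y - X / s"
  define \<kappa> where "\<kappa> = k y + f s / s"
  have X: "X > 0" using y l by (smt (verit) mult_nonneg_nonpos)
  have d: "d > 0" "d \<le> l * X" using s X y by (auto simp: d_def intro: order_trans[rotated])
  have \<kappa>: "\<kappa> \<ge> 0" using nonneg_k[OF y(1)] nonneg_f[of s] s by (simp add: \<kappa>_def)
  have iter: "\<psi> X \<le> real n * \<kappa> + \<psi> (X - real n * d)" if "real n * d \<le> X" for n
    using that
  proof (induction n)
    case (Suc n)
    then have "d \<le> X - real n * d" "real n * d \<le> X" using d by (auto simp: algebra_simps)
    then have "\<psi> (X - real n * d) \<le> \<kappa> + \<psi> (X - real n * d - d)"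
      unfolding \<kappa>_def using d by (intro \<psi>_single_step[OF y(1) s(1) d_def]) auto
    with Suc.IH \<open>real n * d \<le> X\<close> show ?case by (simp add: algebra_simps)
  qed simp
  define n where "n = nat \<lceil>(1 - l) * X / d\<rceil>"
  have "0 \<le> (1 - l) * X / d" using l X d by simp
  then have n: "(1 - l) * X / d \<le> real n" "real n \<le> (1 - l) * X / d + 1"
    unfolding n_def by linarith+
  have n1: "(1 - l) * X \<le> real n * d" using n(1) d by (simp add: field_simps)
  have "real n * d \<le> ((1 - l) * X / d + 1) * d" using n(2) d by (intro mult_right_mono) auto
  also have "\<dots> = (1 - l) * X + d" using d by (simp add: field_simps)
  also have "\<dots> \<le> X" using d by (simp add: algebra_simps)
  finally have "\<psi> X \<le> real n * \<kappa> + \<psi> (X - real n * d)" by (rule iter)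
  also have "\<dots> \<le> ((1 - l) * X / d + 1) * \<kappa> + \<psi> (l * X)"
    using n(2) \<kappa> n1 by (intro add_mono mult_right_mono monoD[OF mono_\<psi>]) (auto simp: algebra_simps)
  finally show ?thesis by (simp add: \<kappa>_def d_def)
qed

lemma \<psi>_eventually_ge:
  assumes c: "c > 1"
  shows "eventually (\<lambda>x. \<rho> powr (\<rho>' - 1) * convex_conj h x / c \<le> \<psi> x) at_top"
proof -
  define c1 where "c1 = c powr (1 / (2 * \<rho>'))"
  have c1: "c1 > 1" using c \<rho>'_gt_1 by (simp add: c1_def)
  have c1c: "c1 powr (2 * \<rho>') = c" using c \<rho>'_gt_1 by (simp add: c1_def powr_powr)
  obtain A where A: "\<And>x. c1 / \<rho> * convex_conj h (\<rho> / c1 * (x - A)) \<le> \<psi> x"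
    using \<psi>_lower[OF c1] by blast
  define t where "t = \<rho> / c1 powr 2"
  have t: "t > 0" using c1 \<rho>_gt_1 by (simp add: t_def)
  have "(t powr \<rho>') / c1 < t powr \<rho>'" using t c1 by (simp add: field_simps)
  from rv_lower[OF rv_h_conj t this]
  have "eventually (\<lambda>x. t powr \<rho>' / c1 * convex_conj h x \<le> convex_conj h (t * x)) at_top" .
  moreover have "eventually (\<lambda>x. A * (c1 / (c1 - 1)) \<le> x) at_top" by (rule eventually_ge_at_top)
  ultimately show ?thesis
  proof eventually_elim
    case (elim x)
    have "A * c1 \<le> x * (c1 - 1)" using elim c1 by (simp add: field_simps)
    then have "x \<le> c1 * (x - A)" by (simp add: algebra_simps)
    then have "t * x \<le> t * (c1 * (x - A))" using t by (intro mult_left_mono) auto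
    also have "\<dots> = \<rho> / c1 * (x - A)" using c1 by (simp add: t_def powr_numeral power2_eq_square)
    finally have tx: "t * x \<le> \<rho> / c1 * (x - A)" .
    have "t powr \<rho>' = \<rho> powr \<rho>' / (c1 powr 2) powr \<rho>'"
      unfolding t_def by (rule powr_divide)
    also have "(c1 powr 2) powr \<rho>' = c" by (simp only: powr_powr c1c)
    finally have "t powr \<rho>' = \<rho> powr \<rho>' / c" .
    then have "\<rho> powr (\<rho>' - 1) * convex_conj h x / c = c1 / \<rho> * (t powr \<rho>' / c1 * convex_conj h x)"
      using c1 \<rho>_gt_1 by (simp add: powr_diff)
    also have "\<dots> \<le> c1 / \<rho> * convex_conj h (t * x)"
      using elim c1 \<rho>_gt_1 by (intro mult_left_mono) auto
    also have "\<dots> \<le> c1 / \<rho> * convex_conj h (\<rho> / c1 * (x - A))"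
      using tx c1 \<rho>_gt_1 by (intro mult_left_mono monoD[OF mono_convex_conj[OF superlinear_h]]) auto
    also have "\<dots> \<le> \<psi> x" by (rule A)
    finally show ?case .
  qed
qed

lemma \<psi>_eventually_le:
  assumes c: "c > 1"
  shows "eventually (\<lambda>x. \<psi> x \<le> c * (\<rho> powr (\<rho>' - 1) * convex_conj h x)) at_top"
proof -
  define c1 where "c1 = c powr (1 / 3)"
  have c1: "c1 > 1" using c by (simp add: c1_def)
  have "c1 ^ 3 = c1 powr 3" using c1 by (simp add: powr_numeral)
  then have cc: "c = c1 ^ 3" using c by (simp add: c1_def powr_powr)
  obtain C where C: "eventually (\<lambda>x. \<psi> x \<le> c1 * convex_conj h (\<rho> * x) / \<rho> + C) at_top"
    using tail_exponent_upper[OF mono_\<psi> c1 \<psi>_block] by blast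
  define B where "B = \<rho> powr (\<rho>' - 1)"
  have B: "B > 0" using \<rho>_gt_1 by (simp add: B_def)
  have B_eq: "\<rho> powr \<rho>' / \<rho> = B" using \<rho>_gt_1 by (simp add: B_def powr_diff)
  have "\<rho> powr \<rho>' < c1 * \<rho> powr \<rho>'" using c1 \<rho>_gt_1 by simp
  with \<rho>_gt_1 have ev: "eventually (\<lambda>x. convex_conj h (\<rho> * x) \<le> c1 * \<rho> powr \<rho>' * convex_conj h x) at_top"
    by (intro rv_upper[OF rv_h_conj]) auto
  have gap: "0 < c1 ^ 2 * (c1 - 1) * B" using c1 B by simp
  have "filterlim (convex_conj h) at_top at_top"
    by (rule filterlim_at_top_mono[OF filterlim_ident])
       (use convex_conj_eventually_ge[OF superlinear_h, of 1] in simp)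
  then have "eventually (\<lambda>x. C / (c1 ^ 2 * (c1 - 1) * B) \<le> convex_conj h x) at_top"
    by (auto simp: filterlim_at_top)
  with C ev show ?thesis
  proof eventually_elim
    case (elim x)
    have "C \<le> c1 ^ 2 * (c1 - 1) * B * convex_conj h x"
      using elim gap by (simp add: pos_divide_le_eq mult.commute)
    moreover have "c1 * convex_conj h (\<rho> * x) / \<rho> \<le> c1 * (c1 * \<rho> powr \<rho>' * convex_conj h x) / \<rho>"
      using elim c1 \<rho>_gt_1 by (intro divide_right_mono mult_left_mono) auto
    moreover have "c1 * (c1 * \<rho> powr \<rho>' * convex_conj h x) / \<rho> = c1 ^ 2 * B * convex_conj h x"
      by (simp add: power2_eq_square flip: B_eq)
    ultimately have "\<psi> x \<le> c1 ^ 2 * B * convex_conj h x + c1 ^ 2 * (c1 - 1) * B * convex_conj h x"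
      using elim by linarith
    also have "\<dots> = c * (B * convex_conj h x)"
      by (simp add: cc algebra_simps power3_eq_cube power2_eq_square)
    finally show ?case by (simp add: B_def)
  qed
qed

lemma \<psi>_asymp: "\<psi> \<sim>[at_top] (\<lambda>x. \<rho> powr (\<rho>' - 1) * convex_conj h x)"
proof (rule asymp_equivI')
  have pos: "eventually (\<lambda>x. \<rho> powr (\<rho>' - 1) * convex_conj h x > 0) at_top"
    using rv_eventually_pos[OF rv_h_conj] by eventually_elim (use \<rho>_gt_1 in simp)
  show "((\<lambda>x. \<psi> x / (\<rho> powr (\<rho>' - 1) * convex_conj h x)) \<longlongrightarrow> 1) at_top"
  proof (rule tendsto_sandwich_factor)
    show "eventually (\<lambda>x. \<psi> x / (\<rho> powr (\<rho>' - 1) * convex_conj h x) \<le> c * 1) at_top" if "c > 1" for c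
      using \<psi>_eventually_le[OF that] pos by eventually_elim (simp add: pos_divide_le_eq)
    show "eventually (\<lambda>x. 1 / c \<le> \<psi> x / (\<rho> powr (\<rho>' - 1) * convex_conj h x)) at_top" if "c > 1" for c
      using \<psi>_eventually_ge[OF that] pos by eventually_elim (use that in \<open>simp add: pos_le_divide_eq\<close>)
  qed simp
qed

end

section \<open>The tail asymptotics\<close>

text \<open>Because \<open>ln 0 = 0\<close>, a vanishing tail probability would show up as a vanishing exponent, which is excluded
for large arguments, and hence by monotonicity for all.\<close>

lemma ln_zero_convention_pos:
  fixes p :: "real \<Rightarrow> real"
  assumes anti: "\<And>x y. 0 < x \<Longrightarrow> x \<le> y \<Longrightarrow> p y \<le> p x" and nonneg: "\<And>x. 0 \<le> p x"
    and ev: "eventually (\<lambda>x. ln (p x) \<noteq> 0) at_top" and x: "x > 0"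
  shows "p x > 0"
proof -
  obtain y where "y \<ge> x" "ln (p y) \<noteq> 0"
    using eventually_happens[OF eventually_conj[OF ev eventually_ge_at_top[of x]]] by auto
  then have "p y > 0" using nonneg[of y] by (cases "p y = 0") auto
  then show ?thesis using anti[OF x \<open>y \<ge> x\<close>] by simp
qed

lemma conjugate_exponent_eq:
  fixes a b :: real
  assumes "a > 1" "1 / a + 1 / b = 1"
  shows "b = a / (a - 1)"
proof -
  have "1 / b = (a - 1) / a" using assms by (simp add: field_simps)
  then have "1 / (1 / b) = a / (a - 1)" by simp
  then show ?thesis by simp
qed

theorem theorem3p1:
  fixes P :: "'a measure" and M Q :: "'a \<Rightarrow> real"
    and S :: "'b measure" and R :: "'b \<Rightarrow> real"
    and f k :: "real \<Rightarrow> real"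
    and r \<alpha> r' \<beta> \<gamma> :: real
  assumes "prob_space P"
    and "prob_space S"
    and "prob_space.indep_var P borel M borel Q"
    and "\<P>(\<omega> in P. M \<omega> \<ge> 0 \<and> Q \<omega> \<ge> 0) = 1"
    and "perpetuity P M Q S R"
    and "\<And>x. x > 0 \<Longrightarrow> k x = - ln (\<P>(\<omega> in P. Q \<omega> > x))"
    and "\<And>x. x > 0 \<Longrightarrow> f x = - x * ln (\<P>(\<omega> in P. M \<omega> > 1 - 1 / x))"
    and "f \<in> regularly_varying r" and "k \<in> regularly_varying \<alpha>"
    and "r > 1" and "\<alpha> > 1"
    and "1 / r + 1 / r' = 1" and "1 / \<alpha> + 1 / \<beta> = 1"
    and "\<gamma> = \<beta> * r' / (\<beta> * r' - 1)"
  shows "convex_conj (convex_conj f \<circ> convex_conj k) \<in> regularly_varying \<gamma> \<and>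
         (\<lambda>x. - ln (\<P>(\<sigma> in S. R \<sigma> > x))) \<sim>[at_top]
         (\<lambda>x. (\<gamma> / (\<gamma> - 1)) powr (\<gamma> - 1) * convex_conj (convex_conj f \<circ> convex_conj k) x)"
proof -
  note k_eq = assms(6) and f_eq = assms(7) and rv_f = assms(8) and rv_k = assms(9)
    and r = assms(10) and \<alpha> = assms(11)
  interpret P: prob_space P by fact
  interpret S: prob_space S by fact
  have M_meas[measurable]: "M \<in> borel_measurable P" and Q_meas[measurable]: "Q \<in> borel_measurable P"
    using P.indep_var_rv1[OF assms(3)] P.indep_var_rv2[OF assms(3)] by auto
  have AE: "AE \<omega> in P. M \<omega> \<ge> 0 \<and> Q \<omega> \<ge> 0"
    using assms(4) P.prob_Collect_eq_1[of "\<lambda>\<omega>. M \<omega> \<ge> 0 \<and> Q \<omega> \<ge> 0"] by simp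
  define q where "q x = P.prob {\<omega>\<in>space P. Q \<omega> > x}" for x
  define m where "m x = P.prob {\<omega>\<in>space P. M \<omega> > 1 - 1 / x}" for x
  have q_anti: "q y \<le> q x" if "x \<le> y" for x y
    unfolding q_def using that by (intro P.finite_measure_mono) auto
  have m_anti: "m y \<le> m x" if "0 < x" "x \<le> y" for x y
  proof -
    have "1 / y \<le> 1 / x" using that by (intro divide_left_mono) auto
    then show ?thesis unfolding m_def by (intro P.finite_measure_mono) auto
  qed
  have kq: "k x = - ln (q x)" if "x > 0" for x using k_eq[OF that] by (simp add: q_def)
  have fm: "f x = - x * ln (m x)" if "x > 0" for x using f_eq[OF that] by (simp add: m_def)
  have q_pos: "q x > 0" if "x > 0" for x
  proof (rule ln_zero_convention_pos[OF _ _ _ that])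
    show "eventually (\<lambda>x. ln (q x) \<noteq> 0) at_top"
      using rv_eventually_pos[OF rv_k] eventually_gt_at_top[of 0]
      by eventually_elim (auto simp: kq)
  qed (auto simp: q_anti, simp add: q_def)
  have m_pos: "m x > 0" if "x > 0" for x
  proof (rule ln_zero_convention_pos[OF _ _ _ that])
    show "eventually (\<lambda>x. ln (m x) \<noteq> 0) at_top"
      using rv_eventually_pos[OF rv_f] eventually_gt_at_top[of 0]
      by eventually_elim (auto simp: fm)
  qed (auto simp: m_anti, simp add: m_def)
  have ln_q: "ln (q x) \<le> 0" if "x > 0" for x using q_pos[OF that] by (simp add: q_def)
  have ln_m: "ln (m x) \<le> 0" if "x > 0" for x using m_pos[OF that] by (simp add: m_def)
  interpret conjugate_pair f k r \<alpha>
  proof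
    show "mono_on {0<..} k"
      by (rule mono_onI) (use q_anti q_pos in \<open>auto simp: kq\<close>)
    show "mono_on {0<..} f"
    proof (rule mono_onI)
      fix x y :: real assume "x \<in> {0<..}" "y \<in> {0<..}" "x \<le> y"
      then have "x * (- ln (m x)) \<le> y * (- ln (m y))"
        using m_anti[of x y] m_pos ln_m by (intro mult_mono) auto
      then show "f x \<le> f y" using \<open>x \<in> {0<..}\<close> \<open>y \<in> {0<..}\<close> by (simp add: fm)
    qed
    show "0 \<le> f z" if "z > 0" for z
      using ln_m[OF that] that by (simp add: fm mult_nonneg_nonpos)
    show "0 \<le> k z" if "z > 0" for z using ln_q[OF that] that by (simp add: kq)
    show "f z = 0" if "0 < z" "z < 1" for z
    proof -
      have "1 - 1 / z < 0" using that by (simp add: field_simps)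
      then have "m z = 1" unfolding m_def
        by (subst P.prob_Collect_eq_1) (use AE in auto)
      then show ?thesis using that by (simp add: fm)
    qed
  qed fact+
  have "AE \<omega> in P. M \<omega> < 1"
  proof -
    have "P.prob {\<omega>\<in>space P. M \<omega> \<ge> 1} \<le> e" if e: "e > 0" for e
    proof -
      have "eventually (\<lambda>x. - ln e * x \<le> f x \<and> x > 0) at_top"
        using superlinear_eventually[OF superlinear_f] eventually_gt_at_top by (rule eventually_conj)
      then obtain x where x: "- ln e * x \<le> f x" "x > 0" using eventually_happens by fastforce
      have "ln (m x) \<le> ln e" using x by (simp add: fm)
      then have "m x \<le> e" using m_pos[OF x(2)] e by simp
      moreover have "P.prob {\<omega>\<in>space P. M \<omega> \<ge> 1} \<le> m x"
        unfolding m_def using x(2) by (intro P.finite_measure_mono) (auto intro: less_le_trans[rotated])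
      ultimately show ?thesis by linarith
    qed
    then have "P.prob {\<omega>\<in>space P. M \<omega> \<ge> 1} \<le> 0" by (rule field_le_epsilon[of _ 0, simplified])
    then have "P.prob {\<omega>\<in>space P. M \<omega> \<ge> 1} = 0" using measure_nonneg[of P] by (simp add: order_antisym)
    then have "AE \<omega> in P. \<not> M \<omega> \<ge> 1" by (subst (asm) P.prob_Collect_eq_0) auto
    then show ?thesis by eventually_elim auto
  qed
  with AE interpret light_tailed_perpetuity f k r \<alpha> P S M Q R
  proof unfold_locales
    show "P.prob {\<omega>\<in>space P. Q \<omega> > x} = exp (- k x)" if "x > 0" for x
      using q_pos[OF that] by (simp add: kq[OF that]) (simp add: q_def)
    show "P.prob {\<omega>\<in>space P. M \<omega> > 1 - 1 / x} = exp (- f x / x)" if "x > 0" for x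
      using m_pos[OF that] that by (simp add: fm[OF that]) (simp add: m_def)
  qed (use assms in auto)
  have r': "r' = r / (r - 1)" and \<beta>: "\<beta> = \<alpha> / (\<alpha> - 1)"
    using conjugate_exponent_eq[OF r assms(12)] conjugate_exponent_eq[OF \<alpha> assms(13)] by auto
  have \<rho>: "\<beta> * r' = \<rho>" by (simp add: \<rho>_def r' \<beta> mult.commute)
  have \<gamma>: "\<gamma> = \<rho>'" using assms(14) by (simp add: \<rho> \<rho>'_def)
  have "\<rho>' / (\<rho>' - 1) = \<rho>" using \<rho>_gt_1 by (simp add: \<rho>'_def field_simps)
  then show ?thesis
    using rv_h_conj \<psi>_asymp unfolding \<gamma> by (simp add: h_def \<psi>_def[abs_def])
qed

end
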